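(* Let $i\in\{1,2,3,3\frac{1}{2}\}$. Let $I$ be an infinite set and, for each $m\in I$, let $J_m$ be an infinite set and let $\langle Z_{m,n}\rangle_{n\in J_m}$ be a family of nonempty $T_i$ spaces. Then the product $\prod_{m\in I}\bigoplus_{n\in J_m}Z_{m,n}$ has a $T_i$ pathwise connectification. Moreover, if $I$ is countably infinite and every $Z_{m,n}$ is metrizable, then $\prod_{m\in I}\bigoplus_{n\in J_m}Z_{m,n}$ has a metrizable pathwise connectification.
   Context: A path-connected space $Y$ is a pathwise connectification of a space $X$ if $X$ can be densely embedded in $Y$ (i.e. there is a topological embedding of $X$ into $Y$ with dense range). A $T_i$ (metrizable) pathwise connectification is a pathwise connectification $Y$ that is itself a $T_i$ (metrizable) space. Here $T_3$ means regular and $T_1$, and $T_{3\frac12}$ means completely regular and $T_1$ (Tychonoff). $\bigoplus$ denotes the topological sum (disjoint union) and products carry the product topology. *)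

theory Defs
  imports "HOL-Analysis.Analysis"
begin

datatype separation_axiom = T1 | T2 | T3 | T3_half

text \<open>The library's \<^const>\<open>regular_space\<close> and \<^const>\<open>completely_regular_space\<close> do not include
  the \<open>T\<^sub>1\<close> axiom.\<close>

fun T_space :: "separation_axiom \<Rightarrow> 'a topology \<Rightarrow> bool" where
  "T_space T1 X \<longleftrightarrow> t1_space X"
| "T_space T2 X \<longleftrightarrow> Hausdorff_space X"
| "T_space T3 X \<longleftrightarrow> regular_space X \<and> t1_space X"
| "T_space T3_half X \<longleftrightarrow> completely_regular_space X \<and> t1_space X"

definition pathwise_connectification :: "'a topology \<Rightarrow> 'b topology \<Rightarrow> bool" where
  "pathwise_connectification X Y \<longleftrightarrow>
     path_connected_space Y \<and>
     (\<exists>e. embedding_map X Y e \<and> Y closure_of (e ` topspace X) = topspace Y)"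

text \<open>HOL cannot quantify existentially over types, so the existence of a connectification has to
  name a type for its points.  The type \<open>'a \<times> 'a \<times> real\<close> loses nothing: in any connectification
  of \<open>X\<close> one may choose a path from \<open>x\<close> to \<open>y\<close> for all points \<open>x, y\<close> of \<open>X\<close>; the union of these
  paths is again a connectification, and its points are named by triples \<open>(x, y, t)\<close>.  The lemmas
  \<open>has_T_pathwise_connectificationI\<close> and \<open>has_metrizable_pathwise_connectificationI\<close> below show
  that a connectification over an arbitrary type suffices.\<close>

definition has_T_pathwise_connectification :: "separation_axiom \<Rightarrow> 'a topology \<Rightarrow> bool" where
  "has_T_pathwise_connectification i X \<longleftrightarrow>
     (\<exists>Y :: ('a \<times> 'a \<times> real) topology. T_space i Y \<and> pathwise_connectification X Y)"

definition has_metrizable_pathwise_connectification :: "'a topology \<Rightarrow> bool" where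
  "has_metrizable_pathwise_connectification X \<longleftrightarrow>
     (\<exists>Y :: ('a \<times> 'a \<times> real) topology. metrizable_space Y \<and> pathwise_connectification X Y)"

lemma T_space_subtopology: "T_space i X \<Longrightarrow> T_space i (subtopology X S)"
  by (cases i) (auto simp: t1_space_subtopology Hausdorff_space_subtopology
      regular_space_subtopology completely_regular_space_subtopology)

lemma homeomorphic_T_space: "X homeomorphic_space Y \<Longrightarrow> T_space i X \<longleftrightarrow> T_space i Y"
  by (cases i) (simp_all add: homeomorphic_t1_space homeomorphic_Hausdorff_space
      homeomorphic_regular_space homeomorphic_completely_regular_space)

lemma pathwise_connectification_homeomorphic:
  assumes "pathwise_connectification X Y" and "Y homeomorphic_space Y'"
  shows "pathwise_connectification X Y'"
proof -
  obtain e where e: "embedding_map X Y e" and d: "Y closure_of (e ` topspace X) = topspace Y"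
    using assms(1) by (auto simp: pathwise_connectification_def)
  obtain k where k: "homeomorphic_map Y Y' k"
    using assms(2) homeomorphic_space by blast
  have sub: "e ` topspace X \<subseteq> topspace Y"
    using homeomorphic_imp_surjective_map[OF e[unfolded embedding_map_def]]
    by (metis inf.cobounded1 topspace_subtopology)
  have "embedding_map X Y' (k \<circ> e)"
    using e k embedding_map_compose surjective_embedding_map by blast
  moreover have "Y' closure_of ((k \<circ> e) ` topspace X) = topspace Y'"
    using homeomorphic_map_closure_of[OF k sub] d homeomorphic_imp_surjective_map[OF k]
    by (simp add: image_comp)
  moreover have "path_connected_space Y'"
    using assms homeomorphic_path_connected_space pathwise_connectification_def by blast
  ultimately show ?thesis
    by (auto simp: pathwise_connectification_def)
qed

lemma pathwise_connectification_retype: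
  fixes X :: "'a topology" and Y :: "'b topology"
  assumes "pathwise_connectification X Y"
  obtains S and Y' :: "('a \<times> 'a \<times> real) topology"
  where "subtopology Y S homeomorphic_space Y'" and "pathwise_connectification X Y'"
proof -
  obtain e where e: "embedding_map X Y e" and d: "Y closure_of (e ` topspace X) = topspace Y"
    using assms by (auto simp: pathwise_connectification_def)
  have "e ` topspace X \<subseteq> topspace Y"
    using homeomorphic_imp_surjective_map[OF e[unfolded embedding_map_def]]
    by (metis inf.cobounded1 topspace_subtopology)
  then have eY: "e x \<in> topspace Y" if "x \<in> topspace X" for x
    using that by blast
  have "\<exists>g. pathin Y g \<and> g 0 = e x \<and> g 1 = e y" if "x \<in> topspace X" "y \<in> topspace X" for x y
    using assms that eY by (auto simp: pathwise_connectification_def path_connected_space_def)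
  then obtain g where g: "\<And>x y. \<lbrakk>x \<in> topspace X; y \<in> topspace X\<rbrakk> \<Longrightarrow>
      pathin Y (g x y) \<and> g x y 0 = e x \<and> g x y 1 = e y"
    by metis
  define D where "D = topspace X \<times> topspace X \<times> {0..1::real}"
  define h where "h = (\<lambda>(x, y, t). g x y t)"
  define S where "S = h ` D"
  have pS: "g x y ` {0..1} \<subseteq> S" if "x \<in> topspace X" "y \<in> topspace X" for x y
    using that by (force simp: S_def D_def h_def)
  have pc: "path_connectedin (subtopology Y S) (g x y ` {0..1})"
    if "x \<in> topspace X" "y \<in> topspace X" for x y
    using path_connectedin_path_image[of Y "g x y"] g[OF that] pS[OF that]
    by (simp add: path_connectedin_subtopology)
  have SY: "S \<subseteq> topspace Y"
    using g path_image_subset_topspace by (fastforce simp: S_def D_def h_def)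
  have topS: "topspace (subtopology Y S) = S"
    using SY by auto
  have pcomp: "path_component_of (subtopology Y S) (g x y s) (g x y t)"
    if "x \<in> topspace X" "y \<in> topspace X" "s \<in> {0..1}" "t \<in> {0..1}" for x y s t
    using pc[OF that(1,2)] that by (auto simp: path_component_of)
  have "path_connected_space (subtopology Y S)"
    unfolding path_connected_space_def topS path_component_of_def[symmetric]
  proof (intro ballI)
    fix p q assume "p \<in> S" "q \<in> S"
    then obtain x y s u v t where xy: "x \<in> topspace X" "y \<in> topspace X" "s \<in> {0..1}" "p = g x y s"
      and uv: "u \<in> topspace X" "v \<in> topspace X" "t \<in> {0..1}" "q = g u v t"
      by (auto simp: S_def D_def h_def)
    have "path_component_of (subtopology Y S) p (e x)"
      using pcomp[of x y s 0] xy g by auto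
    moreover have "path_component_of (subtopology Y S) (e x) (e u)"
      using pcomp[of x u 0 1] xy uv g by auto
    moreover have "path_component_of (subtopology Y S) (e u) q"
      using pcomp[of u v 0 t] uv g by auto
    ultimately show "path_component_of (subtopology Y S) p q"
      by (meson path_component_of_trans)
  qed
  moreover have eS: "e ` topspace X \<subseteq> S"
  proof (clarify)
    fix x assume "x \<in> topspace X"
    then show "e x \<in> S"
      using g[of x x] pS[of x x] by force
  qed
  moreover have "embedding_map X (subtopology Y S) e"
    using e eS by (simp add: embedding_map_in_subtopology)
  moreover have "subtopology Y S closure_of (e ` topspace X) = topspace (subtopology Y S)"
    using d eS SY by (auto simp: closure_of_subtopology inf.absorb2)
  ultimately have conn: "pathwise_connectification X (subtopology Y S)"
    by (auto simp: pathwise_connectification_def)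
  define r where "r = inv_into D h"
  have hr: "h (r p) = p" if "p \<in> S" for p
    using that by (simp add: r_def S_def f_inv_into_f)
  define Y' where "Y' = pullback_topology (r ` S) h Y"
  have topY': "topspace Y' = r ` S"
    using SY hr by (auto simp: Y'_def topspace_pullback_topology)
  have "continuous_map (subtopology Y S) Y' r"
    unfolding Y'_def
  proof (rule continuous_map_pullback')
    show "continuous_map (subtopology Y S) Y (h \<circ> r)"
      using continuous_map_from_subtopology[OF continuous_map_id]
      by (rule continuous_map_eq) (use hr in auto)
  qed auto
  moreover have "continuous_map Y' (subtopology Y S) h"
    unfolding continuous_map_in_subtopology topY'
    using continuous_map_pullback[OF continuous_map_id, of "r ` S" h Y] hr
    by (auto simp: Y'_def)
  ultimately have "homeomorphic_maps (subtopology Y S) Y' r h"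
    using hr topY' by (auto simp: homeomorphic_maps_def)
  then have "subtopology Y S homeomorphic_space Y'"
    using homeomorphic_maps_imp_homeomorphic_space by blast
  with conn pathwise_connectification_homeomorphic show thesis
    using that by blast
qed

lemma has_T_pathwise_connectificationI:
  fixes X :: "'a topology" and Y :: "'b topology"
  assumes "T_space i Y" and "pathwise_connectification X Y"
  shows "has_T_pathwise_connectification i X"
  using assms(2)
proof (rule pathwise_connectification_retype)
  fix S and Y' :: "('a \<times> 'a \<times> real) topology"
  assume "subtopology Y S homeomorphic_space Y'" and "pathwise_connectification X Y'"
  then show ?thesis
    using T_space_subtopology[OF assms(1)] homeomorphic_T_space
    unfolding has_T_pathwise_connectification_def by blast
qed

lemma has_metrizable_pathwise_connectificationI:
  fixes X :: "'a topology" and Y :: "'b topology"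
  assumes "metrizable_space Y" and "pathwise_connectification X Y"
  shows "has_metrizable_pathwise_connectification X"
  using assms(2)
proof (rule pathwise_connectification_retype)
  fix S and Y' :: "('a \<times> 'a \<times> real) topology"
  assume "subtopology Y S homeomorphic_space Y'" and "pathwise_connectification X Y'"
  then show ?thesis
    using metrizable_space_subtopology[OF assms(1)] homeomorphic_metrizable_space
    unfolding has_metrizable_pathwise_connectification_def by blast
qed

end

theory Submission
  imports Defs
begin

text \<open>Write \<open>X\<^sub>m\<close> for the \<open>m\<close>-th sum. As \<open>J\<^sub>m\<close> is infinite, \<open>X\<^sub>m\<close> maps onto the discrete space of
  integers by a continuous \<open>q\<^sub>m\<close>. Integer sequences embed densely into the real
  line by a variant of the continued-fraction expansion: the \<open>j\<close>-th digit is locally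
  constant on the open set of reals whose expansion does not stop before \<open>j\<close>. Using a bijection of
  \<open>I\<close> with \<open>I \<times> \<nat>\<close>, the power \<open>\<real>\<^sup>I\<close> carries in the same way digits indexed by \<open>I\<close>, and every integer
  family occurs as the digits of a point \<open>\<psi> \<alpha>\<close>.

  The connectification consists of pairs of a point \<open>l\<close> of \<open>\<real>\<^sup>I\<close> and points of the open cones over the
  \<open>X\<^sub>m\<close>; the \<open>m\<close>-th height vanishes exactly when the \<open>m\<close>-th digit of \<open>l\<close> is undefined, and
  otherwise the base point lies in the part of \<open>X\<^sub>m\<close> named by that digit. A point \<open>x\<close> of the product
  sits over the \<open>l\<close> with digits \<open>q\<^sub>m (x\<^sub>m)\<close>. Each \<open>x\<close> lies on a continuous section over all of \<open>\<real>\<^sup>I\<close>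
  that follows \<open>x\<close> where the digits agree with those of \<open>x\<close> and uses base points elsewhere. All
  sections pass through the point over \<open>0\<close>, where every coordinate is an apex, so their union is
  path-connected; and the product is dense since the range of \<open>\<psi>\<close> is dense in \<open>\<real>\<^sup>I\<close>. All \<open>T\<^sub>i\<close>
  axioms, and metrizability for countable \<open>I\<close>, pass to the cones, their product and its subspaces.\<close>

section \<open>Open cones\<close>

text \<open>Height 0 alone sets the apex apart from the points over the base, whose heights are
  positive. The first component is a junk value, which may or may not lie in the base.\<close>

definition cone_apex :: "'a \<times> real" where
  "cone_apex = (undefined, 0)"

text \<open>Neighbourhoods of the apex are the sets containing all points of small height, so this is
  coarser than the quotient topology and stays metrizable for metrizable bases.\<close>

definition open_cone :: "'a topology \<Rightarrow> ('a \<times> real) topology" where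
  "open_cone X = topology (\<lambda>U. U \<subseteq> insert cone_apex (topspace X \<times> {0<..}) \<and>
     openin (prod_topology X euclideanreal) (U - {cone_apex}) \<and>
     (cone_apex \<in> U \<longrightarrow> (\<exists>\<epsilon>>0. topspace X \<times> {0<..<\<epsilon>} \<subseteq> U)))"

lemma openin_open_cone:
  "openin (open_cone X) U \<longleftrightarrow> U \<subseteq> insert cone_apex (topspace X \<times> {0<..}) \<and>
     openin (prod_topology X euclideanreal) (U - {cone_apex}) \<and>
     (cone_apex \<in> U \<longrightarrow> (\<exists>\<epsilon>>0. topspace X \<times> {0<..<\<epsilon>} \<subseteq> U))"
proof -
  let ?P = "\<lambda>U. U \<subseteq> insert cone_apex (topspace X \<times> {0<..}) \<and>
     openin (prod_topology X euclideanreal) (U - {cone_apex}) \<and>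
     (cone_apex \<in> U \<longrightarrow> (\<exists>\<epsilon>>0. topspace X \<times> {0<..<\<epsilon>} \<subseteq> U))"
  have "istopology ?P"
    unfolding istopology_def
  proof (intro conjI allI impI)
    fix S T assume S: "?P S" and T: "?P T"
    have "S \<inter> T - {cone_apex} = (S - {cone_apex}) \<inter> (T - {cone_apex})"
      by auto
    then show "openin (prod_topology X euclideanreal) (S \<inter> T - {cone_apex})"
      using S T by (metis openin_Int)
    show "S \<inter> T \<subseteq> insert cone_apex (topspace X \<times> {0<..})"
      using S by blast
    assume "cone_apex \<in> S \<inter> T"
    then obtain d e where "d > 0" "topspace X \<times> {0<..<d} \<subseteq> S" "e > 0" "topspace X \<times> {0<..<e} \<subseteq> T"
      using S T by auto
    then show "\<exists>\<epsilon>>0. topspace X \<times> {0<..<\<epsilon>} \<subseteq> S \<inter> T"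
      by (intro exI[of _ "min d e"]) auto
  next
    fix K assume K: "\<forall>S\<in>K. ?P S"
    have "\<Union>K - {cone_apex} = (\<Union>S\<in>K. S - {cone_apex})"
      by auto
    then show "openin (prod_topology X euclideanreal) (\<Union>K - {cone_apex})"
      using K by (metis (mono_tags, lifting) imageE openin_Union)
    show "\<Union>K \<subseteq> insert cone_apex (topspace X \<times> {0<..})"
      using K by blast
    assume "cone_apex \<in> \<Union>K"
    then obtain S where "S \<in> K" "cone_apex \<in> S" by blast
    then show "\<exists>\<epsilon>>0. topspace X \<times> {0<..<\<epsilon>} \<subseteq> \<Union>K"
      using K by (meson Union_upper order_trans)
  qed
  then show ?thesis
    by (simp add: open_cone_def)
qed

lemma snd_cone_apex [simp]: "snd cone_apex = 0"
  by (simp add: cone_apex_def)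

lemma openin_prod_half_line:
  "openin X S \<Longrightarrow> openin (prod_topology X euclideanreal) (S \<times> {0<..})"
  by (simp add: openin_prod_Times_iff)

lemma topspace_open_cone [simp]:
  "topspace (open_cone X) = insert cone_apex (topspace X \<times> {0<..})" (is "_ = ?C")
proof -
  have "?C - {cone_apex} = topspace X \<times> {0<..}"
    by (auto simp: cone_apex_def)
  then have "openin (open_cone X) ?C"
    by (auto simp: openin_open_cone openin_prod_half_line intro: exI[of _ 1])
  then show ?thesis
    by (metis openin_open_cone openin_subset openin_topspace subset_antisym)
qed

lemma openin_open_cone_prod:
  assumes "openin (prod_topology X euclideanreal) U"
  shows "openin (open_cone X) (U \<inter> UNIV \<times> {0<..})"
proof -
  have "U \<subseteq> topspace X \<times> UNIV"
    using openin_subset[OF assms] by simp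
  then have "U \<inter> UNIV \<times> {0<..} = U \<inter> topspace X \<times> {0<..}"
    by auto
  moreover have "openin (prod_topology X euclideanreal) (U \<inter> topspace X \<times> {0<..})"
    using assms openin_prod_half_line by blast
  moreover have "cone_apex \<notin> U \<inter> topspace X \<times> {0<..}"
    by (simp add: cone_apex_def)
  ultimately show ?thesis
    by (auto simp: openin_open_cone)
qed

text \<open>The apex has height 0, so a set of positive heights misses it and sees only the
  product-topology clause of openness.\<close>

lemma subtopology_open_cone:
  "subtopology (open_cone X) (S \<times> {0<..}) = subtopology (prod_topology X euclideanreal) (S \<times> {0<..})"
proof -
  have "\<exists>U'. openin (prod_topology X euclideanreal) U' \<and> U \<inter> S \<times> {0<..} = U' \<inter> S \<times> {0<..}"
    if "openin (open_cone X) U" for U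
    using that by (intro exI[of _ "U - {cone_apex}"]) (auto simp: openin_open_cone cone_apex_def)
  moreover have "\<exists>U'. openin (open_cone X) U' \<and> U \<inter> S \<times> {0<..} = U' \<inter> S \<times> {0<..}"
    if "openin (prod_topology X euclideanreal) U" for U
    using openin_open_cone_prod[OF that] by blast
  ultimately show ?thesis
    unfolding topology_eq openin_subtopology by metis
qed

text \<open>Continuity of \<open>h\<close> matters only where \<open>f\<close> is positive: a
  neighbourhood of the apex constrains just the height, so it receives a whole open set of the form
  \<open>f s < \<epsilon>\<close>.\<close>

lemma continuous_map_into_open_cone:
  assumes f: "continuous_map S euclideanreal f"
    and h: "continuous_map (subtopology S {s. 0 < f s}) X h"
  shows "continuous_map S (open_cone X) (\<lambda>s. if 0 < f s then (h s, f s) else cone_apex)"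
    (is "continuous_map _ _ ?k")
  unfolding continuous_map_def
proof (intro conjI allI impI Pi_I)
  have hX: "h s \<in> topspace X" if "s \<in> topspace S" "0 < f s" for s
    using continuous_map_image_subset_topspace[OF h] that by auto
  then show "?k s \<in> topspace (open_cone X)" if "s \<in> topspace S" for s
    using that by auto
  have pos: "openin S {s \<in> topspace S. 0 < f s}"
    using openin_continuous_map_preimage[OF f, of "{0<..}"] by simp
  have sub: "subtopology S {s. 0 < f s} = subtopology S {s \<in> topspace S. 0 < f s}"
    by (metis Collect_conj_eq Int_commute subtopology_restrict Collect_mem_eq)
  have hf: "continuous_map (subtopology S {s. 0 < f s}) (prod_topology X euclideanreal) (\<lambda>s. (h s, f s))"
    using h f by (simp add: continuous_map_paired continuous_map_from_subtopology)
  fix U assume U: "openin (open_cone X) U"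
  then have "openin (subtopology S {s. 0 < f s})
      {s \<in> topspace (subtopology S {s. 0 < f s}). (h s, f s) \<in> U - {cone_apex}}"
    by (intro openin_continuous_map_preimage[OF hf]) (auto simp: openin_open_cone)
  then have 1: "openin S {s \<in> topspace S. 0 < f s \<and> (h s, f s) \<in> U}" (is "openin S ?A")
    unfolding sub openin_open_subtopology[OF pos]
    by (rule back_subst[where P = "openin S", OF conjunct1]) (auto simp: cone_apex_def)
  show "openin S {s \<in> topspace S. ?k s \<in> U}"
  proof (cases "cone_apex \<in> U")
    case True
    then obtain \<epsilon> where \<epsilon>: "\<epsilon> > 0" "topspace X \<times> {0<..<\<epsilon>} \<subseteq> U"
      using U by (auto simp: openin_open_cone)
    have "openin S {s \<in> topspace S. f s < \<epsilon>}"
      using openin_continuous_map_preimage[OF f, of "{..<\<epsilon>}"] by simp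
    then have "openin S (?A \<union> {s \<in> topspace S. f s < \<epsilon>})"
      using 1 by blast
    moreover have "{s \<in> topspace S. ?k s \<in> U} = ?A \<union> {s \<in> topspace S. f s < \<epsilon>}"
      using True \<epsilon> hX by auto
    ultimately show ?thesis
      by simp
  next
    case False
    then have "{s \<in> topspace S. ?k s \<in> U} = ?A"
      by auto
    with 1 show ?thesis by simp
  qed
qed

lemma continuous_map_open_cone_snd: "continuous_map (open_cone X) euclideanreal snd"
proof -
  have "openin (open_cone X) {p \<in> topspace (open_cone X). snd p \<in> V}" if V: "open V" for V
    unfolding openin_open_cone
  proof (intro conjI impI)
    have "{p \<in> topspace (open_cone X). snd p \<in> V} - {cone_apex} = topspace X \<times> (V \<inter> {0<..})"
      by (auto simp: cone_apex_def)
    then show "openin (prod_topology X euclideanreal) ({p \<in> topspace (open_cone X). snd p \<in> V} - {cone_apex})"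
      using V by (simp add: openin_prod_Times_iff open_Int)
    assume "cone_apex \<in> {p \<in> topspace (open_cone X). snd p \<in> V}"
    then obtain \<epsilon> where "\<epsilon> > 0" "ball 0 \<epsilon> \<subseteq> V"
      using V open_contains_ball by (metis mem_Collect_eq snd_cone_apex)
    then show "\<exists>\<epsilon>>0. topspace X \<times> {0<..<\<epsilon>} \<subseteq> {p \<in> topspace (open_cone X). snd p \<in> V}"
      by (intro exI[of _ \<epsilon>]) (auto simp: subset_iff dist_real_def)
  qed auto
  then show ?thesis
    by (simp add: continuous_map_def)
qed

lemma continuous_map_open_cone_fst:
  "continuous_map (subtopology (open_cone X) (UNIV \<times> {0<..})) X fst"
  unfolding subtopology_open_cone
  by (simp add: continuous_map_fst continuous_map_from_subtopology)

section \<open>Separation axioms for cones over sums\<close>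

lemma regular_spaceD:
  assumes "regular_space X" "closedin X C" "a \<in> topspace X" "a \<notin> C"
  obtains U V where "openin X U" "openin X V" "a \<in> U" "C \<subseteq> V" "disjnt U V"
proof -
  have "\<exists>U V. openin X U \<and> openin X V \<and> a \<in> U \<and> C \<subseteq> V \<and> disjnt U V"
    using assms(1)[unfolded regular_space_def, rule_format, of C a] assms(2-4) by simp
  then show thesis
    using that by blast
qed

lemma completely_regular_spaceD:
  fixes X :: "'a topology"
  assumes "completely_regular_space X" "closedin X C" "a \<in> topspace X" "a \<notin> C"
  obtains f :: "'a \<Rightarrow> real" where "continuous_map X (top_of_set {0..1}) f" "f a = 0" "f ` C \<subseteq> {1}"
  using assms(1)[unfolded completely_regular_space_def, rule_format, of C a] assms(2-4) that by blast

text \<open>Regularity does not pass up from arbitrary open covers, so every point comes with a real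
  function \<open>g\<close>. Either the positivity set of \<open>g\<close> is a good neighbourhood
  and thresholds of \<open>g\<close> keep away from its boundary, or sublevel sets of
  \<open>g\<close> form a neighbourhood base. In a cone over a sum these are the points over a
  summand and the apex.\<close>

lemma T_space_local:
  fixes W :: "'a topology"
  assumes "\<And>p. p \<in> topspace W \<Longrightarrow> \<exists>g. continuous_map W euclideanreal g \<and>
      (g p > 0 \<and> T_space i (subtopology W {x. g x > 0}) \<or>
       g p = 0 \<and> (\<forall>q \<in> topspace W - {p}. g q > 0) \<and>
       (\<forall>U. openin W U \<and> p \<in> U \<longrightarrow> (\<exists>\<epsilon>>0. {x \<in> topspace W. g x < \<epsilon>} \<subseteq> U)))"
  shows "T_space i W"
proof -
  have pre: "openin W {x \<in> topspace W. g x \<in> V}" if "continuous_map W euclideanreal g" "open V" for g :: "'a \<Rightarrow> real" and V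
    using openin_continuous_map_preimage[OF that(1), of V] that by simp
  have opn: "openin W U" 
    if g: "continuous_map W euclideanreal g" and "openin (subtopology W {x. g x > 0}) U" for g :: "'a \<Rightarrow> real" and U
  proof -
    have "subtopology W {x. g x > 0} = subtopology W (topspace W \<inter> {x. g x > 0})"
      by (simp add: subtopology_restrict)
    also have "topspace W \<inter> {x. g x > 0} = {x \<in> topspace W. g x \<in> {0<..}}"
      by auto
    finally show ?thesis
      using that openin_open_subtopology[OF pre[OF g, of "{0<..}"]] by auto
  qed
  \<comment> \<open>Shared by the cases \<open>T1\<close>, \<open>T3\<close> and
    \<open>T3_half\<close>, whose axioms each include \<open>t1_space\<close>.\<close>
  have t1: "t1_space W" if sub: "\<And>X :: 'a topology. T_space i X \<Longrightarrow> t1_space X"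
  proof -
    have "\<exists>U. openin W U \<and> p \<in> U \<and> q \<notin> U" if p: "p \<in> topspace W" and q: "q \<in> topspace W" and "p \<noteq> q" for p q
    proof -
      obtain g where g: "continuous_map W euclideanreal g" and
        gp: "g p > 0 \<and> T_space i (subtopology W {x. g x > 0}) \<or>
         g p = 0 \<and> (\<forall>q \<in> topspace W - {p}. g q > 0)"
        using assms[OF p] by metis
      show ?thesis
      proof (cases "g p > 0")
        case True
        then have t1: "t1_space (subtopology W {x. g x > 0})"
          using gp sub by simp
        show ?thesis
        proof (cases "g q > 0")
          case gq: True
          then obtain U where "openin (subtopology W {x. g x > 0}) U" "p \<in> U" "q \<notin> U"
            using t1 p q \<open>p \<noteq> q\<close> True unfolding t1_space_def
            by (metis IntI mem_Collect_eq topspace_subtopology)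
          then show ?thesis using opn[OF g] by blast
        next
          case False
          then show ?thesis using pre[OF g, of "{0<..}"] p True
            by (intro exI[of _ "{x \<in> topspace W. g x \<in> {0<..}}"]) auto
        qed
      next
        case False
        then have "g p = 0" "g q > 0"
          using gp q \<open>p \<noteq> q\<close> by auto
        then show ?thesis using pre[OF g, of "{..<g q}"] p
          by (intro exI[of _ "{x \<in> topspace W. g x \<in> {..<g q}}"]) auto
      qed
    qed
    then show ?thesis by (simp add: t1_space_def)
  qed
  show ?thesis
  proof (cases i)
    case T1
    then show ?thesis
      using t1 by simp
  next
    case T2
    have "\<exists>U V. openin W U \<and> openin W V \<and> p \<in> U \<and> q \<in> V \<and> disjnt U V" if p: "p \<in> topspace W" and q: "q \<in> topspace W" and "p \<noteq> q" for p q
    proof -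
      obtain g where g: "continuous_map W euclideanreal g" and
        gp: "g p > 0 \<and> T_space i (subtopology W {x. g x > 0}) \<or>
         g p = 0 \<and> (\<forall>q \<in> topspace W - {p}. g q > 0)"
        using assms[OF p] by metis
      show ?thesis
      proof (cases "g p > 0 \<and> g q > 0")
        case True
        then have "Hausdorff_space (subtopology W {x. g x > 0})"
          using gp T2 by simp
        then obtain U V where "openin (subtopology W {x. g x > 0}) U" "openin (subtopology W {x. g x > 0}) V"
            "p \<in> U" "q \<in> V" "disjnt U V"
          using p q \<open>p \<noteq> q\<close> True unfolding Hausdorff_space_def
          by (metis IntI mem_Collect_eq topspace_subtopology)
        then show ?thesis using opn[OF g] by blast
      next
        case False
        \<comment> \<open>If the two values are not both positive they differ, so their midpoint is
          a separating threshold.\<close>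
        let ?m = "(g p + g q) / 2"
        let ?A = "{x \<in> topspace W. g x \<in> {..<?m}}" and ?B = "{x \<in> topspace W. g x \<in> {?m<..}}"
        have AB: "openin W ?A" "openin W ?B" "disjnt ?A ?B"
          using pre[OF g, of "{..<?m}"] pre[OF g, of "{?m<..}"] by (auto simp: disjnt_iff)
        have "g p \<noteq> g q"
          using False gp q \<open>p \<noteq> q\<close> by (metis DiffI singletonD)
        then have "p \<in> ?A \<and> q \<in> ?B \<or> p \<in> ?B \<and> q \<in> ?A"
          using p q by (auto simp: field_simps)
        then show ?thesis
          using AB by (meson disjnt_sym)
      qed
    qed
    then show ?thesis using T2 by (simp add: Hausdorff_space_def)
  next
    case T3
    have "t1_space W"
      by (rule t1) (use T3 in auto)
    moreover have "\<exists>U V. openin W U \<and> openin W V \<and> p \<in> U \<and> C \<subseteq> V \<and> disjnt U V"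
      if C: "closedin W C" and p: "p \<in> topspace W" "p \<notin> C" for C p
      using assms[OF p(1)]
    proof (elim exE conjE disjE)
      fix g :: "'a \<Rightarrow> real"
      assume g: "continuous_map W euclideanreal g" and "g p > 0" and reg: "T_space i (subtopology W {x. g x > 0})"
      have "closedin (subtopology W {x. g x > 0}) (C \<inter> {x. g x > 0})"
        using C by (auto simp: closedin_subtopology)
      moreover have "regular_space (subtopology W {x. g x > 0})"
        using reg T3 by simp
      moreover have "p \<in> topspace (subtopology W {x. g x > 0})" "p \<notin> C \<inter> {x. g x > 0}"
        using p \<open>g p > 0\<close> by auto
      ultimately obtain U V where UV: "openin (subtopology W {x. g x > 0}) U" "openin (subtopology W {x. g x > 0}) V"
          "p \<in> U" "C \<inter> {x. g x > 0} \<subseteq> V" "disjnt U V"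
        by (meson regular_spaceD)
      \<comment> \<open>\<open>V\<close> covers \<open>C\<close> only where \<open>g\<close> is
        positive. Adding the set below \<open>g p / 2\<close> covers the rest, and cutting
        \<open>U\<close> above that threshold keeps the sets disjoint.\<close>
      let ?U = "U \<inter> {x \<in> topspace W. g x \<in> {g p/2<..}}" and ?V = "V \<union> {x \<in> topspace W. g x \<in> {..<g p/2}}"
      have "openin W ?U" "openin W ?V"
        by (intro openin_Int openin_Un opn[OF g] pre[OF g] UV; simp)+
      moreover have "C \<subseteq> ?V"
        using UV(4) closedin_subset[OF C] \<open>g p > 0\<close> by force
      moreover have "p \<in> ?U" "disjnt ?U ?V"
        using p UV \<open>g p > 0\<close> by (auto simp: disjnt_iff)
      ultimately show ?thesis
        by blast
    next
      fix g :: "'a \<Rightarrow> real"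
      assume g: "continuous_map W euclideanreal g" and "g p = 0"
        and base: "\<forall>U. openin W U \<and> p \<in> U \<longrightarrow> (\<exists>\<epsilon>>0. {x \<in> topspace W. g x < \<epsilon>} \<subseteq> U)"
      have "openin W (topspace W - C)"
        using C by blast
      then obtain \<epsilon> where \<epsilon>: "\<epsilon> > 0" "{x \<in> topspace W. g x < \<epsilon>} \<subseteq> topspace W - C"
        using base p by blast
      let ?U = "{x \<in> topspace W. g x \<in> {..<\<epsilon>/2}}" and ?V = "{x \<in> topspace W. g x \<in> {\<epsilon>/2<..}}"
      have "openin W ?U" "openin W ?V"
        by (intro pre[OF g]; simp)+
      moreover have "\<epsilon> / 2 < g x" if "x \<in> C" for x
        using \<epsilon> closedin_subset[OF C] that by (cases "g x < \<epsilon>") auto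
      then have "C \<subseteq> ?V"
        using closedin_subset[OF C] by auto
      moreover have "p \<in> ?U" "disjnt ?U ?V"
        using \<epsilon>(1) p \<open>g p = 0\<close> by (auto simp: disjnt_iff)
      ultimately show ?thesis
        by blast
    qed
    ultimately show ?thesis
      using T3 by (auto simp: regular_space_def)
  next
    case T3_half
    have "t1_space W"
      by (rule t1) (use T3_half in auto)
    moreover have "\<exists>f. continuous_map W euclideanreal f \<and> f p = 0 \<and> f ` C \<subseteq> {1}"
      if C: "closedin W C" and p: "p \<in> topspace W" "p \<notin> C" for C p
      using assms[OF p(1)]
    proof (elim exE conjE disjE)
      fix g :: "'a \<Rightarrow> real"
      let ?D = "subtopology W {x. g x > 0}"
      assume g: "continuous_map W euclideanreal g" and "g p > 0" and reg: "T_space i ?D"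
      have "closedin ?D (C \<inter> {x. g x > 0})"
        using C by (auto simp: closedin_subtopology)
      moreover have "completely_regular_space ?D"
        using reg T3_half by simp
      moreover have "p \<in> topspace ?D" "p \<notin> C \<inter> {x. g x > 0}"
        using p \<open>g p > 0\<close> by auto
      ultimately obtain \<phi> :: "'a \<Rightarrow> real" where \<phi>: "continuous_map ?D (top_of_set {0..1}) \<phi>" "\<phi> p = 0"
          "\<phi> ` (C \<inter> {x. g x > 0}) \<subseteq> {1}"
        by (meson completely_regular_spaceD)
      have \<phi>1: "\<phi> x \<in> {0..1}" if "x \<in> topspace W" "g x > 0" for x
        using continuous_map_image_subset_topspace[OF \<phi>(1)] that by auto
      \<comment> \<open>The second term is 0 at \<open>p\<close> and 1 once
        \<open>g x \<le> g p / 2\<close>, so \<open>m\<close> extends continuously by the constant 1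
        beyond the positivity set of \<open>g\<close>.\<close>
      define m where "m = (\<lambda>x. max (\<phi> x) (min 1 (\<bar>g x - g p\<bar> * (2 / g p))))"
      let ?f = "\<lambda>x. if g x > 0 then m x else 1"
      have far: "m x = 1" if "x \<in> topspace W" "g x > 0" "g x < g p / 2" for x
      proof -
        have "\<bar>g x - g p\<bar> * (2 / g p) \<ge> 1"
          using that by (simp add: field_simps)
        then show ?thesis
          using \<phi>1[OF that(1,2)] by (auto simp: m_def)
      qed
      have "continuous_map W euclideanreal ?f"
      proof (rule pasting_lemma)
        let ?T = "\<lambda>b. {x \<in> topspace W. g x \<in> (if b then {0<..} else {..<g p/2})}"
        let ?F = "\<lambda>b. if b then m else (\<lambda>x. 1)"
        show "openin W (?T b)" for b
          by (intro pre[OF g]) auto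
        have "?T True = topspace W \<inter> {x. g x > 0}"
          by auto
        then have "subtopology W (?T True) = ?D"
          by (simp only: subtopology_restrict)
        have "continuous_map ?D euclideanreal \<phi>"
          using \<phi>(1) by (simp add: continuous_map_in_subtopology)
        moreover have "continuous_map ?D euclideanreal (\<lambda>x. \<bar>g x - g p\<bar>)"
          by (rule continuous_map_real_abs[OF continuous_map_diff[OF continuous_map_from_subtopology[OF g]]]) simp
        then have "continuous_map ?D euclideanreal (\<lambda>x. \<bar>g x - g p\<bar> * (2 / g p))"
          by (rule continuous_map_real_mult) simp
        then have "continuous_map ?D euclideanreal (\<lambda>x. min 1 (\<bar>g x - g p\<bar> * (2 / g p)))"
          by (rule continuous_map_real_min[rotated]) simp
        ultimately have "continuous_map ?D euclideanreal m"
          unfolding m_def by (intro continuous_map_real_max)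
        with \<open>subtopology W (?T True) = ?D\<close>
        show "continuous_map (subtopology W (?T b)) euclideanreal (?F b)" for b
          by (cases b) simp_all
        show "?F a x = ?F b x" if "x \<in> topspace W \<inter> ?T a \<inter> ?T b" for a b x
          using that by (cases a; cases b) (simp_all add: far)
        show "\<exists>b. b \<in> UNIV \<and> x \<in> ?T b \<and> ?f x = ?F b x" if "x \<in> topspace W" for x
          using that \<open>g p > 0\<close> by (intro exI[of _ "g x > 0"]) auto
      qed
      moreover have "?f p = 0" "?f ` C \<subseteq> {1}"
        using \<phi>(2,3) \<open>g p > 0\<close> by (auto simp: m_def image_subset_iff)
      ultimately show ?thesis
        by blast
    next
      fix g :: "'a \<Rightarrow> real"
      assume g: "continuous_map W euclideanreal g" and "g p = 0"
        and base: "\<forall>U. openin W U \<and> p \<in> U \<longrightarrow> (\<exists>\<epsilon>>0. {x \<in> topspace W. g x < \<epsilon>} \<subseteq> U)"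
      have "openin W (topspace W - C)"
        using C by blast
      then obtain \<epsilon> where \<epsilon>: "\<epsilon> > 0" "{x \<in> topspace W. g x < \<epsilon>} \<subseteq> topspace W - C"
        using base p by blast
      \<comment> \<open>The set where \<open>g\<close> is below \<open>\<epsilon>\<close> misses
        \<open>C\<close>, so the capped quotient is 1 on \<open>C\<close> and 0 at
        \<open>p\<close>.\<close>
      have "continuous_map W euclideanreal (\<lambda>x. min 1 (g x * (1/\<epsilon>)))"
        using g by (intro continuous_map_real_min continuous_map_real_mult) auto
      moreover have "1 \<le> g x / \<epsilon>" if "x \<in> C" for x
        using \<epsilon> closedin_subset[OF C] that by (cases "g x < \<epsilon>") (auto simp: field_simps)
      ultimately show ?thesis
        using \<open>g p = 0\<close> by (intro exI[of _ "\<lambda>x. min 1 (g x * (1/\<epsilon>))"]) auto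
    qed
    ultimately show ?thesis
      using T3_half by (auto simp: completely_regular_space_alt)
  qed
qed

section \<open>Products, and cones over topological sums\<close>

lemma T_space_prod_topology:
  assumes "T_space i X" "T_space i Y"
  shows "T_space i (prod_topology X Y)"
  using assms
  by (cases i) (auto simp: t1_space_prod_topology Hausdorff_space_prod_topology
      regular_space_prod_topology completely_regular_space_prod_topology)

lemma T_space_product_topology:
  assumes "\<And>m. m \<in> I \<Longrightarrow> T_space i (X m)"
  shows "T_space i (product_topology X I)"
  using assms
  by (cases i) (auto simp: t1_space_product_topology Hausdorff_space_product_topology
      regular_space_product_topology completely_regular_space_product_topology)

lemma metrizable_imp_T_space: "metrizable_space X \<Longrightarrow> T_space i X"
  by (cases i) (simp_all add: metrizable_imp_t1_space metrizable_imp_Hausdorff_space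
      metrizable_imp_regular_space metrizable_imp_completely_regular_space)

text \<open>At the apex the function is continuous because its value never exceeds the height,
  elsewhere because \<open>A\<close> is clopen in the base.\<close>

lemma continuous_map_open_cone_restrict:
  assumes A: "openin X (topspace X \<inter> A)" "openin X (topspace X - A)"
  shows "continuous_map (open_cone X) euclideanreal (\<lambda>(a, t). if a \<in> A then t else 0)"
    (is "continuous_map _ _ ?g")
proof -
  have "openin (open_cone X) {p \<in> topspace (open_cone X). ?g p \<in> V}" if V: "open V" for V
    unfolding openin_open_cone
  proof (intro conjI impI)
    let ?B = "if 0 \<in> V then (topspace X - A) \<times> {0<..} else {}"
    have "{p \<in> topspace (open_cone X). ?g p \<in> V} - {cone_apex} = (topspace X \<inter> A) \<times> (V \<inter> {0<..}) \<union> ?B"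
      by (auto simp: cone_apex_def split: if_splits)
    moreover have "openin (prod_topology X euclideanreal) ((topspace X \<inter> A) \<times> (V \<inter> {0<..}))"
      using V A by (simp add: openin_prod_Times_iff open_Int)
    moreover have "openin (prod_topology X euclideanreal) ?B"
      using A by (simp add: openin_prod_half_line)
    ultimately show "openin (prod_topology X euclideanreal) ({p \<in> topspace (open_cone X). ?g p \<in> V} - {cone_apex})"
      by (simp only: openin_Un)
    assume "cone_apex \<in> {p \<in> topspace (open_cone X). ?g p \<in> V}"
    then have 0: "0 \<in> V"
      by (simp add: cone_apex_def)
    then obtain \<epsilon> where "\<epsilon> > 0" "ball 0 \<epsilon> \<subseteq> V"
      using V by (meson open_contains_ball)
    then show "\<exists>\<epsilon>>0. topspace X \<times> {0<..<\<epsilon>} \<subseteq> {p \<in> topspace (open_cone X). ?g p \<in> V}"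
      using 0 by (intro exI[of _ \<epsilon>]) (auto simp: subset_iff dist_real_def)
  qed auto
  then show ?thesis
    by (simp add: continuous_map_def)
qed

text \<open>The apex is the unique zero of the height. The height cut off outside summand
  \<open>n\<close> is positive exactly on a copy of \<open>Z n\<close> times a half-line, so the
  axiom has to be known for the summands alone.\<close>

lemma T_space_open_cone_sum:
  assumes "\<And>n. n \<in> J \<Longrightarrow> T_space i (Z n)"
  shows "T_space i (open_cone (sum_topology Z J))"
proof (rule T_space_local)
  let ?X = "sum_topology Z J"
  fix p assume p: "p \<in> topspace (open_cone ?X)"
  show "\<exists>g. continuous_map (open_cone ?X) euclideanreal g \<and>
      (g p > 0 \<and> T_space i (subtopology (open_cone ?X) {x. g x > 0}) \<or>
       g p = 0 \<and> (\<forall>q \<in> topspace (open_cone ?X) - {p}. g q > 0) \<and>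
       (\<forall>U. openin (open_cone ?X) U \<and> p \<in> U \<longrightarrow> (\<exists>\<epsilon>>0. {x \<in> topspace (open_cone ?X). g x < \<epsilon>} \<subseteq> U)))"
  proof (cases "p = cone_apex")
    case True
    have "\<exists>\<epsilon>>0. {x \<in> topspace (open_cone ?X). snd x < \<epsilon>} \<subseteq> U"
      if U: "openin (open_cone ?X) U" "p \<in> U" for U
    proof -
      obtain \<epsilon> where "\<epsilon> > 0" "topspace ?X \<times> {0<..<\<epsilon>} \<subseteq> U"
        using U True unfolding openin_open_cone by metis
      then show ?thesis
        using U True by (intro exI[of _ \<epsilon>]) auto
    qed
    moreover have "\<forall>q \<in> topspace (open_cone ?X) - {p}. snd q > 0" "snd p = 0"
      using True by auto
    ultimately show ?thesis
      using continuous_map_open_cone_snd by (intro exI[of _ snd] conjI disjI2) auto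
  next
    case False
    with p obtain n z t where p: "p = ((n, z), t)" "n \<in> J" "z \<in> topspace (Z n)" "t > 0"
      by auto
    define A where "A = Pair n ` topspace (Z n)"
    define g where "g = (\<lambda>(a, t::real). if a \<in> A then t else 0)"
    have A: "openin ?X A" "openin ?X (topspace ?X - A)"
    proof -
      show "openin ?X A"
        using open_map_component_injection[OF p(2), of Z] unfolding A_def open_map_def by blast
      have "closedin ?X A"
        using closed_map_component_injection[OF p(2), of Z] unfolding A_def closed_map_def by blast
      then show "openin ?X (topspace ?X - A)"
        by blast
    qed
    have "topspace ?X \<inter> A = A"
      using A(1) openin_subset by blast
    then have "continuous_map (open_cone ?X) euclideanreal g"
      unfolding g_def using A by (intro continuous_map_open_cone_restrict) simp_all
    moreover have "g p > 0"
      using p by (simp add: g_def A_def)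
    moreover have "T_space i (subtopology (open_cone ?X) {x. g x > 0})"
    proof -
      have "{x. g x > 0} = A \<times> {0<..}"
        by (auto simp: g_def split: if_splits)
      moreover have "Z n homeomorphic_space subtopology ?X A"
        using embedding_map_imp_homeomorphic_space[OF embedding_map_component_injection[OF p(2)]]
        by (simp add: A_def)
      then have "T_space i (subtopology ?X A)"
        using assms[OF p(2)] homeomorphic_T_space by blast
      then have "T_space i (subtopology (open_cone ?X) (A \<times> {0<..}))"
        unfolding subtopology_open_cone subtopology_Times
        by (rule T_space_prod_topology)
          (rule T_space_subtopology[OF metrizable_imp_T_space[OF metrizable_space_euclidean]])
      ultimately show ?thesis
        by simp
    qed
    ultimately show ?thesis
      by blast
  qed
qed

section \<open>Metrizability of cones and sums\<close>

text \<open>The bound holds for all arguments, also outside the carrier: the cone metric evaluates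
  \<open>d\<close> at the junk first component of the apex.\<close>

lemma metrizable_space_bounded_metricE:
  assumes "metrizable_space X"
  obtains d where "Metric_space (topspace X) d" "Metric_space.mtopology (topspace X) d = X"
    "\<And>x y. d x y \<le> 1"
proof -
  obtain M d where "Metric_space M d" and X: "X = Metric_space.mtopology M d"
    using assms by (auto simp: metrizable_space_def)
  then interpret Metric_space M d by simp
  have "topspace X = M"
    using X by simp
  then show thesis
    using that[of "capped_dist 1"] capped_dist[of 1] mtopology_capped_metric[of 1] X
    by (simp add: capped_dist_def)
qed

text \<open>This is the triangle inequality of the cone metric for heights \<open>r\<close>,
  \<open>s\<close>, \<open>t\<close>. If \<open>s\<close> is at least \<open>m = min r t\<close>,
  the weights on the right dominate. Otherwise the descent to \<open>s\<close> costs an extra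
  \<open>2 * (m - s)\<close> in height, which outweighs the loss of at most \<open>m - s\<close>
  through smaller weights, as \<open>x \<le> 1\<close>.\<close>

lemma min_mult_triangle:
  fixes r s t :: real
  assumes "0 \<le> r" "0 \<le> s" "0 \<le> t" "x \<le> y + z" "x \<le> 1" "0 \<le> y" "0 \<le> z"
  shows "\<bar>r - t\<bar> + min r t * x \<le> (\<bar>r - s\<bar> + min r s * y) + (\<bar>s - t\<bar> + min s t * z)"
proof (cases "min r t \<le> s")
  case True
  have "min r t * x \<le> min r t * y + min r t * z"
    using mult_left_mono[OF assms(4), of "min r t"] assms(1,3) by (simp add: distrib_left)
  also have "\<dots> \<le> min r s * y + min s t * z"
    using True assms by (intro add_mono mult_right_mono) auto
  finally show ?thesis
    by linarith
next
  case False
  define m where "m = min r t"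
  have m: "s < m" "\<bar>r - s\<bar> + \<bar>s - t\<bar> = \<bar>r - t\<bar> + 2 * (m - s)" "min r s = s" "min s t = s"
    using False by (auto simp: m_def min_def split: if_splits)
  have "s * x \<le> s * y + s * z"
    using mult_left_mono[OF assms(4), of s] assms(2) by (simp add: distrib_left)
  moreover have "(m - s) * x \<le> (m - s) * 1"
    using m(1) assms(5) by (intro mult_left_mono) auto
  ultimately have "m * x \<le> s * y + s * z + (m - s)"
    by (simp add: left_diff_distrib)
  then show ?thesis
    using m by (simp add: m_def[symmetric])
qed

text \<open>The metric \<open>D\<close> adds to the difference of heights the base distance weighted
  by the smaller height. The weight lets base distances fade towards the apex, in agreement with its
  neighbourhoods being given by height.\<close>

lemma metrizable_space_open_cone:
  assumes "metrizable_space X"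
  shows "metrizable_space (open_cone X)"
proof -
  obtain d where "Metric_space (topspace X) d" and dX: "Metric_space.mtopology (topspace X) d = X"
    and d1: "\<And>x y. d x y \<le> 1"
    using metrizable_space_bounded_metricE[OF assms] by metis
  interpret d: Metric_space "topspace X" d by fact
  define C where "C = insert cone_apex (topspace X \<times> {0::real<..})"
  define D where "D = (\<lambda>p q. \<bar>snd p - snd q\<bar> + min \<bar>snd p\<bar> \<bar>snd q\<bar> * d (fst p) (fst q))"
  have C: "p = cone_apex \<or> p \<noteq> cone_apex \<and> fst p \<in> topspace X \<and> 0 < snd p" if "p \<in> C" for p
    using that by (auto simp: C_def cone_apex_def)
  interpret D: Metric_space C D
  proof
    show "0 \<le> D p q" for p q
      by (simp add: D_def)
    show "D p q = D q p" for p q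
      by (simp add: D_def d.commute abs_minus_commute min.commute)
    show "D p q = 0 \<longleftrightarrow> p = q" if "p \<in> C" "q \<in> C" for p q
    proof
      assume "D p q = 0"
      moreover have "0 \<le> min \<bar>snd p\<bar> \<bar>snd q\<bar> * d (fst p) (fst q)"
        by simp
      ultimately have *: "snd p = snd q" "min \<bar>snd p\<bar> \<bar>snd q\<bar> * d (fst p) (fst q) = 0"
        unfolding D_def by linarith+
      then show "p = q"
        using C[OF that(1)] C[OF that(2)] by (auto intro: prod_eqI)
    next
      assume "p = q"
      then show "D p q = 0"
        using C[OF that(1)] by (auto simp: D_def)
    qed
    show "D p r \<le> D p q + D q r" if "p \<in> C" "q \<in> C" "r \<in> C" for p q r
    proof -
      have snd: "0 \<le> snd p" "0 \<le> snd q" "0 \<le> snd r"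
        using that[THEN C] by auto
      show ?thesis
      proof (cases "p = cone_apex \<or> q = cone_apex \<or> r = cone_apex")
        case True
        \<comment> \<open>If the middle point is the apex, the left side is at most the larger of
          the two heights, hence at most their sum; if an end point is, its weight is 0 and heights
          alone decide.\<close>
        have "0 \<le> min (snd p) (snd q) * d (fst p) (fst q)" "0 \<le> min (snd q) (snd r) * d (fst q) (fst r)"
          using snd by simp_all
        moreover have "min (snd p) (snd r) * d (fst p) (fst r) \<le> min (snd p) (snd r) * 1"
          using snd d1 by (intro mult_left_mono) auto
        moreover have "min (snd p) (snd r) * d (fst p) (fst r) = 0 \<or> snd q = 0"
          using True snd by auto
        ultimately show ?thesis
          using snd unfolding D_def abs_of_nonneg[OF snd(1)] abs_of_nonneg[OF snd(2)] abs_of_nonneg[OF snd(3)]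
          by linarith
      next
        case False
        then have "d (fst p) (fst r) \<le> d (fst p) (fst q) + d (fst q) (fst r)"
          using that[THEN C] by (auto intro: d.triangle)
        then show ?thesis
          using min_mult_triangle[of "snd p" "snd q" "snd r" "d (fst p) (fst r)"] snd d1 by (simp add: D_def)
      qed
    qed
  qed
  have "openin D.mtopology U \<longleftrightarrow> openin (open_cone X) U" for U
  proof
    assume U: "openin D.mtopology U"
    then have UC: "U \<subseteq> C" and ball: "\<And>p. p \<in> U \<Longrightarrow> \<exists>r>0. D.mball p r \<subseteq> U"
      by (auto simp: D.openin_mtopology)
    have "openin (prod_topology X euclideanreal) (U - {cone_apex})"
      unfolding openin_prod_topology_alt
    proof (intro allI impI)
      fix a t assume at: "(a, t) \<in> U - {cone_apex}"
      then have a: "a \<in> topspace X" and t: "t > 0"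
        using UC C by fastforce+
      obtain r where r: "r > 0" "D.mball (a, t) r \<subseteq> U"
        using ball at by blast
      \<comment> \<open>The weight \<open>min t s\<close> is at most \<open>t\<close>, so radius
        \<open>r / (2 * t)\<close> in the base and \<open>r / 2\<close> in the height together stay
        below \<open>r\<close>.\<close>
      define A where "A = d.mball a (r / (2 * t))"
      define B where "B = {t - r/2<..<t + r/2} \<inter> {0<..}"
      have "openin X A"
        unfolding A_def by (subst dX[symmetric]) simp
      moreover have "openin euclideanreal B"
        by (auto simp: B_def)
      moreover have "a \<in> A" "t \<in> B"
        using a t r by (auto simp: A_def B_def)
      moreover have "A \<times> B \<subseteq> U - {cone_apex}"
      proof clarify
        fix b s assume "b \<in> A" "s \<in> B"
        then have b: "b \<in> topspace X" "d a b < r / (2 * t)" and s: "s > 0" "\<bar>t - s\<bar> < r / 2"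
          by (auto simp: A_def B_def abs_if)
        have "min t s * d a b \<le> t * d a b"
          by (intro mult_right_mono) auto
        also have "\<dots> < r / 2"
          using b t by (simp add: field_simps)
        finally have "D (a, t) (b, s) < r"
          using s t by (simp add: D_def)
        moreover have "(a, t) \<in> C" "(b, s) \<in> C"
          using a b s t by (auto simp: C_def)
        ultimately have "(b, s) \<in> U"
          using r(2) by auto
        then show "(b, s) \<in> U - {cone_apex}"
          using s by (simp add: cone_apex_def)
      qed
      ultimately show "\<exists>A B. openin X A \<and> openin euclideanreal B \<and> a \<in> A \<and> t \<in> B \<and> A \<times> B \<subseteq> U - {cone_apex}"
        by blast
    qed
    moreover have "\<exists>\<epsilon>>0. topspace X \<times> {0<..<\<epsilon>} \<subseteq> U" if apex: "cone_apex \<in> U"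
    proof -
      obtain r where r: "r > 0" "D.mball cone_apex r \<subseteq> U"
        using ball apex by blast
      have "topspace X \<times> {0<..<r} \<subseteq> D.mball cone_apex r"
        unfolding D.in_mball subset_iff by (auto simp: D_def C_def)
      then show ?thesis
        using r by blast
    qed
    ultimately show "openin (open_cone X) U"
      using UC by (simp add: openin_open_cone C_def)
  next
    assume U: "openin (open_cone X) U"
    then have UC: "U \<subseteq> C"
      by (simp add: openin_open_cone C_def)
    have "\<exists>r>0. D.mball p r \<subseteq> U" if p: "p \<in> U" for p
    proof (cases "p = cone_apex")
      case True
      then obtain \<epsilon> where \<epsilon>: "\<epsilon> > 0" "topspace X \<times> {0<..<\<epsilon>} \<subseteq> U"
        using U p by (auto simp: openin_open_cone)
      have "q \<in> U" if "q \<in> D.mball p \<epsilon>" for q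
        using that True p \<epsilon>(2) C[of q] unfolding D.in_mball by (cases q) (auto simp: D_def)
      then show ?thesis
        using \<epsilon> by blast
    next
      case False
      obtain a t where pat: "p = (a, t)"
        by fastforce
      with False p UC C have a: "a \<in> topspace X" and t: "t > 0"
        by fastforce+
      have "openin (prod_topology X euclideanreal) (U - {cone_apex})" "(a, t) \<in> U - {cone_apex}"
        using U p False pat by (auto simp: openin_open_cone)
      then obtain A B where AB: "openin X A" "open B" "a \<in> A" "t \<in> B" "A \<times> B \<subseteq> U"
        using openin_prod_topology_alt[THEN iffD1, rule_format, of X euclideanreal "U - {cone_apex}" a t] by auto
      obtain \<delta> where \<delta>: "\<delta> > 0" "d.mball a \<delta> \<subseteq> A"
        using AB(1,3) d.openin_mtopology[of A] unfolding dX by blast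
      obtain e where e: "e > 0" "ball t e \<subseteq> B"
        using AB(2,4) by (meson open_contains_ball)
      \<comment> \<open>The bound \<open>t / 2\<close> keeps the other point off the apex, with
        weight at least \<open>t / 2\<close>; then \<open>\<delta> * t / 2\<close> forces base
        distance below \<open>\<delta>\<close>, and \<open>e\<close> keeps the height in
        \<open>B\<close>.\<close>
      define r where "r = min (min e (t / 2)) (\<delta> * t / 2)"
      have "r > 0"
        using e \<delta> t by (simp add: r_def)
      moreover have "D.mball p r \<subseteq> U"
      proof
        fix q assume "q \<in> D.mball p r"
        then obtain b s where q: "q = (b, s)" "(b, s) \<in> C" and D: "D (a, t) (b, s) < r"
          using pat by (cases q) auto
        have "0 \<le> min \<bar>t\<bar> \<bar>s\<bar> * d a b"
          by simp
        moreover have "D (a, t) (b, s) = \<bar>t - s\<bar> + min \<bar>t\<bar> \<bar>s\<bar> * d a b"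
          by (simp add: D_def)
        ultimately have ts: "\<bar>t - s\<bar> < r" and md: "min \<bar>t\<bar> \<bar>s\<bar> * d a b < r"
          using D by linarith+
        then have s: "t / 2 < s"
          using t unfolding r_def by linarith
        then have b: "b \<in> topspace X"
          using q(2) t by (auto simp: C_def cone_apex_def)
        have "t / 2 * d a b \<le> min \<bar>t\<bar> \<bar>s\<bar> * d a b"
          using s t by (intro mult_right_mono) auto
        also have "\<dots> < \<delta> * t / 2"
          using md by (simp add: r_def)
        finally have "d a b < \<delta>"
          using t by (simp add: field_simps)
        then have "b \<in> A"
          using \<delta> a b by auto
        moreover have "s \<in> B"
          using e ts by (auto simp: r_def dist_real_def)
        ultimately show "q \<in> U"
          using AB q by blast
      qed
      ultimately show ?thesis
        by blast
    qed
    then show "openin D.mtopology U"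
      using UC by (auto simp: D.openin_mtopology)
  qed
  then have "open_cone X = D.mtopology"
    by (simp add: topology_eq)
  then show ?thesis
    using D.metrizable_space_mtopology by simp
qed

text \<open>Metrics bounded by 1 extend by distance 1 between different summands; the bound gives
  the triangle inequality for detours through another summand.\<close>

lemma metrizable_space_sum_topology:
  assumes "\<And>n. n \<in> J \<Longrightarrow> metrizable_space (Z n)"
  shows "metrizable_space (sum_topology Z J)"
proof -
  have "\<exists>d. Metric_space (topspace (Z n)) d \<and> Metric_space.mtopology (topspace (Z n)) d = Z n \<and> (\<forall>x y. d x y \<le> 1)"
    if "n \<in> J" for n
    using metrizable_space_bounded_metricE[OF assms[OF that]] by metis
  then obtain d where d: "\<And>n. n \<in> J \<Longrightarrow> Metric_space (topspace (Z n)) (d n)"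
      and dZ: "\<And>n. n \<in> J \<Longrightarrow> Metric_space.mtopology (topspace (Z n)) (d n) = Z n"
      and d1: "\<And>n x y. n \<in> J \<Longrightarrow> d n x y \<le> 1"
    by metis
  define M where "M = Sigma J (topspace \<circ> Z)"
  \<comment> \<open>\<open>d n\<close> is a metric for \<open>n \<in> J\<close> only, while
    nonnegativity and symmetry are demanded for all arguments; hence the default 0 for equal indices
    outside \<open>J\<close>.\<close>
  define D where "D = (\<lambda>(n, x) (m, y). if n = m \<and> n \<in> J then d n x y else if n = m then 0 else 1)"
  interpret D: Metric_space M D
  proof
    show "0 \<le> D p q" for p q
      using Metric_space.nonneg[OF d] by (auto simp: D_def split: prod.splits)
    show "D p q = D q p" for p q
      using Metric_space.commute[OF d] by (auto simp: D_def split: prod.splits)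
    show "D p q = 0 \<longleftrightarrow> p = q" if "p \<in> M" "q \<in> M" for p q
      using Metric_space.zero[OF d] that by (auto simp: D_def M_def split: if_splits)
    have "d n x y \<le> 2" if "n \<in> J" for n x y
      using d1[OF that, of x y] by simp
    then show "D p r \<le> D p q + D q r" if "p \<in> M" "q \<in> M" "r \<in> M" for p q r
      using that Metric_space.triangle[OF d] d1 Metric_space.nonneg[OF d]
      by (auto simp: D_def M_def intro: add_increasing)
  qed
  have "openin D.mtopology U \<longleftrightarrow> openin (sum_topology Z J) U" for U
  proof
    assume "openin D.mtopology U"
    then have UM: "U \<subseteq> M" and ball: "\<And>p. p \<in> U \<Longrightarrow> \<exists>r>0. D.mball p r \<subseteq> U"
      by (auto simp: D.openin_mtopology)
    have "openin (Z n) {x. (n, x) \<in> U}" if n: "n \<in> J" for n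
    proof -
      interpret n: Metric_space "topspace (Z n)" "d n"
        using d n by simp
      have "openin n.mtopology {x. (n, x) \<in> U}"
        unfolding n.openin_mtopology
      proof (intro conjI allI impI)
        show "{x. (n, x) \<in> U} \<subseteq> topspace (Z n)"
          using UM by (auto simp: M_def)
        fix x assume "x \<in> {x. (n, x) \<in> U}"
        then obtain r where r: "r > 0" "D.mball (n, x) r \<subseteq> U"
          using ball by blast
        have "n.mball x r \<subseteq> {x. (n, x) \<in> U}"
        proof
          fix y assume "y \<in> n.mball x r"
          then have "(n, y) \<in> D.mball (n, x) r"
            using n unfolding D.in_mball by (auto simp: M_def D_def)
          then show "y \<in> {x. (n, x) \<in> U}"
            using r by blast
        qed
        then show "\<exists>r>0. n.mball x r \<subseteq> {x. (n, x) \<in> U}"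
          using r by blast
      qed
      then show ?thesis
        by (simp add: dZ[OF n])
    qed
    then show "openin (sum_topology Z J) U"
      using UM by (simp add: openin_sum_topology M_def)
  next
    assume "openin (sum_topology Z J) U"
    then have UM: "U \<subseteq> M" and opn: "\<And>n. n \<in> J \<Longrightarrow> openin (Z n) {x. (n, x) \<in> U}"
      by (auto simp: openin_sum_topology M_def)
    have "\<exists>r>0. D.mball p r \<subseteq> U" if p: "p \<in> U" for p
    proof -
      obtain n x where nx: "p = (n, x)" "n \<in> J"
        using UM p by (auto simp: M_def)
      interpret n: Metric_space "topspace (Z n)" "d n"
        using d nx by simp
      have "openin n.mtopology {x. (n, x) \<in> U}"
        using opn nx dZ by simp
      then obtain r where r: "r > 0" "n.mball x r \<subseteq> {x. (n, x) \<in> U}"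
        using p nx by (auto simp: n.openin_mtopology)
      \<comment> \<open>Radius at most 1 confines the ball to the summand of
        \<open>p\<close>.\<close>
      have "D.mball p (min r 1) \<subseteq> U"
      proof
        fix q assume "q \<in> D.mball p (min r 1)"
        then have "q = (n, snd q)" "snd q \<in> n.mball x r"
          using nx unfolding D.in_mball by (auto simp: D_def M_def split: if_splits)
        then show "q \<in> U"
          using r by (metis mem_Collect_eq subsetD)
      qed
      then show ?thesis
        using r by (intro exI[of _ "min r 1"]) auto
    qed
    then show "openin D.mtopology U"
      using UM by (auto simp: D.openin_mtopology)
  qed
  then have "sum_topology Z J = D.mtopology"
    by (simp add: topology_eq)
  then show ?thesis
    using D.metrizable_space_mtopology by simp
qed

section \<open>An expansion of real numbers with integer digits\<close>

text \<open>The map \<open>x \<mapsto> - cot (\<pi> x)\<close> plays the role of the Gauss map of continued fractions: it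
  has period 1 and \<open>branch k\<close> is its inverse on \<open>{k<..<k + 1}\<close>. The advantage is that all inverse
  branches are increasing contractions. At integers \<open>tan\<close> has the junk value 0.\<close>

definition cot_map :: "real \<Rightarrow> real" where
  "cot_map x = tan (x * pi - pi / 2)"

definition branch :: "int \<Rightarrow> real \<Rightarrow> real" where
  "branch k y = of_int k + (1 / 2 + arctan y / pi)"

primrec digit :: "nat \<Rightarrow> real \<Rightarrow> int" where
  "digit 0 x = \<lfloor>x\<rfloor>"
| "digit (Suc j) x = digit j (cot_map x)"

text \<open>\<open>gap j x\<close> is positive exactly if \<open>digit j x\<close> is meaningful, that is, if none of
  \<open>x, cot_map x, \<dots>\<close> up to the \<open>j\<close>-th iterate is an integer.\<close>

primrec gap :: "nat \<Rightarrow> real \<Rightarrow> real" where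
  "gap 0 x = \<bar>sin (x * pi)\<bar>"
| "gap (Suc j) x = \<bar>sin (x * pi)\<bar> * gap j (cot_map x)"

primrec expand_upto :: "nat \<Rightarrow> (nat \<Rightarrow> int) \<Rightarrow> real" where
  "expand_upto 0 \<alpha> = 0"
| "expand_upto (Suc n) \<alpha> = branch (\<alpha> 0) (expand_upto n (\<lambda>i. \<alpha> (Suc i)))"

definition expand :: "(nat \<Rightarrow> int) \<Rightarrow> real" where
  "expand \<alpha> = lim (\<lambda>n. expand_upto n \<alpha>)"

section \<open>Branches as inverses of the cotangent map\<close>

lemma branch_bounds: "of_int k < branch k y" "branch k y < of_int k + 1"
  using arctan_bounded[of y] by (auto simp: branch_def field_simps)

lemma floor_branch: "\<lfloor>branch k y\<rfloor> = k"
  using branch_bounds[of k y] by (intro floor_unique) auto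

lemma branch_notin_Ints: "branch k y \<notin> \<int>"
  using branch_bounds[of k y] by (auto elim!: Ints_cases)

lemma cot_map_branch: "cot_map (branch k y) = y"
proof -
  have "branch k y * pi - pi / 2 = arctan y + of_int k * pi"
    by (simp add: branch_def field_simps)
  then show ?thesis
    by (simp add: cot_map_def tan_periodic_int tan_arctan)
qed

text \<open>\<open>arctan\<close> undoes \<open>tan\<close> on the principal interval, where
  \<open>frac x * pi - pi / 2\<close> lies for non-integer \<open>x\<close>; the integer part only
  shifts by periods.\<close>

lemma branch_cot_map:
  assumes "x \<notin> \<int>"
  shows "branch \<lfloor>x\<rfloor> (cot_map x) = x"
proof -
  have "frac x > 0" "frac x < 1"
    using assms by (auto simp: frac_gt_0_iff frac_lt_1)
  moreover have "x * pi - pi / 2 = (frac x * pi - pi / 2) + of_int \<lfloor>x\<rfloor> * pi"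
    by (simp add: frac_def algebra_simps)
  moreover have "- (pi / 2) < frac x * pi - pi / 2" "frac x * pi - pi / 2 < pi / 2"
    using calculation by auto
  ultimately have "arctan (cot_map x) = frac x * pi - pi / 2"
    unfolding cot_map_def by (metis tan_periodic_int arctan_tan)
  then show ?thesis
    by (simp add: branch_def frac_def field_simps)
qed

section \<open>Contraction and convergence of expansions\<close>

lemma arctan_lipschitz: "\<bar>arctan y - arctan z\<bar> \<le> \<bar>y - z\<bar>"
proof -
  have *: "\<bar>arctan y - arctan z\<bar> \<le> \<bar>y - z\<bar>" if yz: "y < z" for y z :: real
  proof -
    obtain \<xi> where \<xi>: "arctan z - arctan y = (z - y) * inverse (1 + \<xi>\<^sup>2)"
      using MVT2[OF yz, of arctan "\<lambda>x. inverse (1 + x\<^sup>2)"] DERIV_arctan by blast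
    have "arctan z - arctan y \<le> (z - y) * 1"
      unfolding \<xi> using yz by (intro mult_left_mono) (auto simp: inverse_le_1_iff)
    then show ?thesis
      using arctan_monotone[OF yz] yz by (simp add: abs_if)
  qed
  show ?thesis
    using *[of y z] *[of z y] by (cases y z rule: linorder_cases) auto
qed

lemma branch_contraction: "\<bar>branch k y - branch k z\<bar> \<le> \<bar>y - z\<bar> / 2"
proof -
  have "\<bar>branch k y - branch k z\<bar> = \<bar>arctan y - arctan z\<bar> / pi"
    by (simp add: branch_def diff_divide_distrib[symmetric] abs_divide)
  also have "\<dots> \<le> \<bar>y - z\<bar> / 2"
    using arctan_lipschitz pi_ge_two by (intro frac_le) auto
  finally show ?thesis .
qed

text \<open>A common digit at position \<open>n\<close> puts both tails into the same unit interval,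
  and each of the \<open>n\<close> common branches in front halves the distance. With
  \<open>p\<close> and \<open>q\<close> free, one bound serves both convergence and continuity in
  the digits.\<close>

lemma expand_upto_close:
  assumes "\<forall>i\<le>n. \<alpha> i = \<beta> i"
  shows "\<bar>expand_upto (Suc (n + p)) \<alpha> - expand_upto (Suc (n + q)) \<beta>\<bar> \<le> (1/2)^n"
  using assms
proof (induction n arbitrary: \<alpha> \<beta>)
  case 0
  then show ?case
    using branch_bounds[of "\<alpha> 0"] by (auto simp: abs_le_iff) (smt (verit))+
next
  case (Suc n)
  let ?a = "expand_upto (Suc (n + p)) (\<lambda>i. \<alpha> (Suc i))" and ?b = "expand_upto (Suc (n + q)) (\<lambda>i. \<beta> (Suc i))"
  have "expand_upto (Suc (Suc n + p)) \<alpha> = branch (\<alpha> 0) ?a" "expand_upto (Suc (Suc n + q)) \<beta> = branch (\<alpha> 0) ?b"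
    using Suc.prems by auto
  then have "\<bar>expand_upto (Suc (Suc n + p)) \<alpha> - expand_upto (Suc (Suc n + q)) \<beta>\<bar> \<le> \<bar>?a - ?b\<bar> / 2"
    using branch_contraction by metis
  also have "\<dots> \<le> (1/2)^n / 2"
    using Suc.IH[of "\<lambda>i. \<alpha> (Suc i)" "\<lambda>i. \<beta> (Suc i)"] Suc.prems by simp
  finally show ?case
    by simp
qed

lemma expand_upto_tendsto: "(\<lambda>n. expand_upto n \<alpha>) \<longlonglongrightarrow> expand \<alpha>"
proof -
  have "Cauchy (\<lambda>n. expand_upto n \<alpha>)"
  proof (rule metric_CauchyI)
    fix e :: real assume "e > 0"
    then obtain n where n: "(1/2)^n < e"
      using real_arch_pow_inv[of e "1/2"] by auto
    have "dist (expand_upto r \<alpha>) (expand_upto s \<alpha>) < e" if "r \<ge> Suc n" "s \<ge> Suc n" for r s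
    proof -
      have "r = Suc (n + (r - Suc n))" "s = Suc (n + (s - Suc n))"
        using that by auto
      then show ?thesis
        using expand_upto_close[of n \<alpha> \<alpha> "r - Suc n" "s - Suc n"] n by (simp add: dist_real_def)
    qed
    then show "\<exists>M. \<forall>m\<ge>M. \<forall>n\<ge>M. dist (expand_upto m \<alpha>) (expand_upto n \<alpha>) < e"
      by blast
  qed
  then show ?thesis
    by (simp add: expand_def Cauchy_convergent_iff convergent_LIMSEQ_iff)
qed

lemma expand_close:
  assumes "\<forall>i\<le>n. \<alpha> i = \<beta> i"
  shows "\<bar>expand \<alpha> - expand \<beta>\<bar> \<le> (1/2)^n"
proof -
  have "(\<lambda>p. \<bar>expand_upto (p + Suc n) \<alpha> - expand_upto (p + Suc n) \<beta>\<bar>) \<longlonglongrightarrow> \<bar>expand \<alpha> - expand \<beta>\<bar>"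
    by (intro tendsto_intros LIMSEQ_ignore_initial_segment expand_upto_tendsto)
  moreover have "\<bar>expand_upto (p + Suc n) \<alpha> - expand_upto (p + Suc n) \<beta>\<bar> \<le> (1/2)^n" for p
    using expand_upto_close[OF assms, of p p] by (simp only: add_Suc_right add.commute)
  ultimately show ?thesis
    by (intro LIMSEQ_le_const2) blast+
qed

text \<open>Branches are continuous, so the recursion survives the limit. The limit is thus itself a
  branch value, strictly between consecutive integers, and its digits can be read off.\<close>

lemma expand_branch: "expand \<alpha> = branch (\<alpha> 0) (expand (\<lambda>i. \<alpha> (Suc i)))"
proof (rule LIMSEQ_unique)
  show "(\<lambda>n. expand_upto (Suc n) \<alpha>) \<longlonglongrightarrow> expand \<alpha>"
    using expand_upto_tendsto by (rule LIMSEQ_Suc)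
  show "(\<lambda>n. expand_upto (Suc n) \<alpha>) \<longlonglongrightarrow> branch (\<alpha> 0) (expand (\<lambda>i. \<alpha> (Suc i)))"
    unfolding expand_upto.simps branch_def
    by (intro tendsto_intros expand_upto_tendsto) auto
qed

lemma digit_expand: "digit j (expand \<alpha>) = \<alpha> j"
proof (induction j arbitrary: \<alpha>)
  case 0
  then show ?case
    by (subst expand_branch) (simp add: floor_branch)
next
  case (Suc j)
  then show ?case
    by (subst expand_branch) (simp add: cot_map_branch)
qed

section \<open>Gaps, digits and density of the expansions\<close>

lemma gap_bounds: "0 \<le> gap j x" "gap j x \<le> 1"
  by (induction j arbitrary: x) (auto simp: abs_mult mult_le_one)

text \<open>Applying \<open>cot_map\<close> to an expansion drops its first digit, so every iterate
  is again a branch value and never an integer.\<close>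

lemma gap_expand_pos: "gap j (expand \<alpha>) > 0"
proof -
  have sin: "sin (branch k y * pi) \<noteq> 0" for k y
    using branch_notin_Ints[of k y] sin_times_pi_eq_0[of "branch k y"] by simp
  show ?thesis
  proof (induction j arbitrary: \<alpha>)
    case 0
    then show ?case
      by (subst expand_branch) (simp add: sin)
  next
    case (Suc j)
    then show ?case
      by (subst expand_branch) (simp add: sin cot_map_branch)
  qed
qed

text \<open>The expansion of the integer 0 stops at once; this puts an apex into every cone
  coordinate over the origin.\<close>

lemma gap_0 [simp]: "gap j 0 = 0"
  by (cases j) auto

lemma isCont_cot_map:
  assumes "sin (x * pi) \<noteq> 0"
  shows "isCont cot_map x"
proof -
  have "cos (x * pi - pi / 2) \<noteq> 0"
    using assms by (simp add: cos_diff)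
  then show ?thesis
    unfolding cot_map_def by (intro continuous_intros)
qed

text \<open>At an integer \<open>cot_map\<close> has a pole, but the factor
  \<open>sin (x * pi)\<close> tends to 0 there and the other factor is at most 1.\<close>

lemma isCont_gap: "isCont (gap j) x"
proof (induction j arbitrary: x)
  case 0
  then show ?case
    by (simp add: gap.simps(1)[abs_def])
next
  case (Suc j)
  show ?case
  proof (cases "sin (x * pi) = 0")
    case True
    have "((\<lambda>y. \<bar>sin (y * pi)\<bar>) \<longlongrightarrow> \<bar>sin (x * pi)\<bar>) (at x)"
      by (intro tendsto_intros)
    then have lim: "((\<lambda>y. \<bar>sin (y * pi)\<bar>) \<longlongrightarrow> 0) (at x)"
      using True by simp
    have le: "gap (Suc j) y \<le> \<bar>sin (y * pi)\<bar>" for y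
      using gap_bounds[of j "cot_map y"] by (simp add: mult_left_le)
    have "(gap (Suc j) \<longlongrightarrow> 0) (at x)"
      by (rule tendsto_sandwich[OF always_eventually[OF allI[OF gap_bounds(1)]]
            always_eventually[OF allI[OF le]] tendsto_const lim])
    moreover have "gap (Suc j) x = 0"
      using True by simp
    ultimately show ?thesis
      by (simp only: isCont_def)
  next
    case False
    have "isCont (\<lambda>y. \<bar>sin (y * pi)\<bar> * gap j (cot_map y)) x"
      by (intro continuous_intros isCont_o2[OF isCont_cot_map[OF False] Suc.IH])
    then show ?thesis
      by (simp add: gap.simps(2)[abs_def])
  qed
qed

text \<open>A positive gap keeps the iterates up to the \<open>j\<close>-th off the integers, so
  \<open>cot_map\<close> is continuous along the way and the final floor is locally
  constant.\<close>

lemma isCont_digit: "gap j x > 0 \<Longrightarrow> isCont (digit j) x"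
proof (induction j arbitrary: x)
  case 0
  then have "x \<notin> \<int>"
    using sin_times_pi_eq_0[of x] by auto
  then have "eventually (\<lambda>y. \<lfloor>y\<rfloor> = \<lfloor>x\<rfloor>) (at x)"
    by (intro eventually_floor_eq[OF tendsto_ident_at])
  then show ?case
    by (simp add: isCont_def tendsto_eventually)
next
  case (Suc j)
  then have "sin (x * pi) \<noteq> 0" "gap j (cot_map x) > 0"
    using gap_bounds(1)[of j "cot_map x"] by (auto simp: zero_less_mult_iff)
  then have "isCont (\<lambda>y. digit j (cot_map y)) x"
    by (intro isCont_o2[OF isCont_cot_map Suc.IH])
  then show ?case
    by (simp add: digit.simps(2)[abs_def])
qed

text \<open>Copying the digits of \<open>x\<close> gives an error that halves with each step;
  \<open>e\<close> pays for moving iterates off the integers, where \<open>branch_cot_map\<close>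
  fails. The bound reproduces itself:
  \<open>e / 2 + (2 * (1/2)^n + e) / 2 = 2 * (1/2)^Suc n + e\<close>.\<close>

lemma expand_near: "e > 0 \<Longrightarrow> \<exists>\<alpha>. \<bar>x - expand \<alpha>\<bar> < 2 * (1/2)^n + e"
proof (induction n arbitrary: x e)
  case 0
  define \<alpha> where "\<alpha> = (\<lambda>i::nat. \<lfloor>x\<rfloor>)"
  have "\<bar>x - expand \<alpha>\<bar> < 2"
    using branch_bounds[of "\<lfloor>x\<rfloor>" "expand (\<lambda>i. \<alpha> (Suc i))"] expand_branch[of \<alpha>]
      of_int_floor_le[of x] real_of_int_floor_add_one_gt[of x] by (simp add: \<alpha>_def abs_if; linarith)
  then show ?case
    using 0 by (intro exI[of _ \<alpha>]) simp
next
  case (Suc n)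
  obtain x' where x': "x' \<notin> \<int>" "\<bar>x - x'\<bar> < e / 2"
  proof (cases "x \<in> \<int>")
    case True
    define d where "d = min (e / 4) (1 / 2)"
    have "d > 0" "d < 1" "d < e / 2"
      using Suc.prems by (auto simp: d_def)
    moreover have "x + d \<notin> \<int>"
    proof
      assume "x + d \<in> \<int>"
      then have "x + d - x \<in> \<int>"
        using True by (metis Ints_diff)
      then show False
        using \<open>d > 0\<close> \<open>d < 1\<close> by (auto elim!: Ints_cases)
    qed
    ultimately show ?thesis
      using that[of "x + d"] by simp
  qed (use Suc.prems that in auto)
  obtain \<beta> where \<beta>: "\<bar>cot_map x' - expand \<beta>\<bar> < 2 * (1/2)^n + e"
    using Suc by blast
  define \<alpha> where "\<alpha> = case_nat \<lfloor>x'\<rfloor> \<beta>"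
  have "expand \<alpha> = branch \<lfloor>x'\<rfloor> (expand \<beta>)"
    by (subst expand_branch) (simp add: \<alpha>_def)
  then have "\<bar>x' - expand \<alpha>\<bar> \<le> \<bar>cot_map x' - expand \<beta>\<bar> / 2"
    using branch_contraction branch_cot_map[OF x'(1)] by metis
  then have "\<bar>x - expand \<alpha>\<bar> < 2 * (1/2)^Suc n + e"
    using \<beta> x'(2) by (simp add: abs_if split: if_splits)
  then show ?case
    by blast
qed

lemma closure_range_expand: "closure (range expand) = UNIV"
proof -
  have "\<exists>y\<in>range expand. dist y x < e" if e: "e > 0" for x e
  proof -
    obtain n where "(1/2::real)^n < e/4"
      using real_arch_pow_inv[of "e/4" "1/2"] e by auto
    moreover obtain \<alpha> where "\<bar>x - expand \<alpha>\<bar> < 2 * (1/2)^n + e/2"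
      using expand_near[of "e/2" x n] e by auto
    ultimately show ?thesis
      by (intro bexI[of _ "expand \<alpha>"]) (auto simp: dist_real_def)
  qed
  then show ?thesis
    by (auto simp: closure_approachable)
qed

lemma continuous_expand: "continuous_on UNIV expand"
proof (rule continuous_on_topological[THEN iffD2], intro ballI allI impI)
  fix \<alpha> :: "nat \<Rightarrow> int" and B assume "open B" "expand \<alpha> \<in> B"
  then obtain e where e: "e > 0" "ball (expand \<alpha>) e \<subseteq> B"
    by (meson open_contains_ball)
  obtain n where n: "(1/2)^n < e"
    using real_arch_pow_inv[of e "1/2"] e by auto
  define A where "A = (\<Inter>i\<in>{..n}. (\<lambda>\<beta>::nat\<Rightarrow>int. \<beta> i) -` {\<alpha> i})"
  have "open A"
    unfolding A_def by (intro open_INT ballI open_vimage open_discrete continuous_on_product_coordinates) auto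
  moreover have "expand \<beta> \<in> B" if "\<beta> \<in> A" for \<beta>
  proof -
    have "\<bar>expand \<alpha> - expand \<beta>\<bar> \<le> (1/2)^n"
      using that by (intro expand_close) (auto simp: A_def)
    then have "expand \<beta> \<in> ball (expand \<alpha>) e"
      using n by (simp add: dist_real_def)
    then show ?thesis
      using e by blast
  qed
  ultimately have "open A \<and> \<alpha> \<in> A \<and> (\<forall>\<beta>\<in>UNIV. \<beta> \<in> A \<longrightarrow> expand \<beta> \<in> B)"
    by (simp add: A_def)
  then show "\<exists>A. open A \<and> \<alpha> \<in> A \<and> (\<forall>\<beta>\<in>UNIV. \<beta> \<in> A \<longrightarrow> expand \<beta> \<in> B)"
    by blast
qed

section \<open>Digits indexed by an infinite set\<close>

text \<open>An infinite cardinal absorbs a countable factor. The bijection splits \<open>I\<close>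
  into sequences indexed by \<open>I\<close> itself, so that each real coordinate can carry a whole
  sequence of digits.\<close>

lemma bij_betw_Times_nat:
  assumes "infinite I"
  obtains b :: "'m \<times> nat \<Rightarrow> 'm" where "bij_betw b (I \<times> UNIV) I"
proof -
  have "(card_of (I \<times> (UNIV :: nat set)), card_of I) \<in> ordIso"
    using card_of_Times_infinite[of I "UNIV :: nat set"] infinite_iff_card_of_nat[of I] assms by simp
  then have "\<exists>b. bij_betw b (I \<times> (UNIV :: nat set)) I"
    by (simp add: card_of_ordIso)
  then show thesis
    using that by metis
qed

lemma euclidean_int_discrete: "(euclidean :: int topology) = discrete_topology UNIV"
  by (simp add: topology_eq open_discrete)

text \<open>The entries of \<open>\<alpha>\<close> at the indices \<open>b (k, j)\<close> become the
  digits of the \<open>k\<close>-th real coordinate. Conversely \<open>r m\<close> names the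
  coordinate and position holding the digit of index \<open>m\<close>; \<open>f m\<close> and
  \<open>c m\<close> are the gap and digit found there.\<close>

lemma product_coding:
  fixes I :: "'m set"
  assumes "infinite I"
  defines "L \<equiv> product_topology (\<lambda>_. euclideanreal) I"
    and "N \<equiv> product_topology (\<lambda>_. discrete_topology (UNIV :: int set)) I"
  obtains f :: "'m \<Rightarrow> ('m \<Rightarrow> real) \<Rightarrow> real" and c :: "'m \<Rightarrow> ('m \<Rightarrow> real) \<Rightarrow> int" and \<psi> l\<^sub>0
  where "\<And>m. m \<in> I \<Longrightarrow> continuous_map L euclideanreal (f m)"
    and "\<And>m. m \<in> I \<Longrightarrow> continuous_map (subtopology L {l. 0 < f m l}) (discrete_topology UNIV) (c m)"
    and "continuous_map N L \<psi>"
    and "\<And>m \<alpha>. m \<in> I \<Longrightarrow> 0 < f m (\<psi> \<alpha>)"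
    and "\<And>m \<alpha>. m \<in> I \<Longrightarrow> c m (\<psi> \<alpha>) = \<alpha> m"
    and "L closure_of (\<psi> ` topspace N) = topspace L"
    and "l\<^sub>0 \<in> topspace L" and "\<And>m. m \<in> I \<Longrightarrow> f m l\<^sub>0 = 0"
proof -
  obtain b :: "'m \<times> nat \<Rightarrow> 'm" where b: "bij_betw b (I \<times> UNIV) I"
    using bij_betw_Times_nat[OF assms(1)] .
  define r where "r = inv_into (I \<times> UNIV) b"
  have rI: "fst (r m) \<in> I" and br: "b (r m) = m" if "m \<in> I" for m
  proof -
    have "r m \<in> I \<times> UNIV"
      unfolding r_def using b that by (metis bij_betw_def inv_into_into)
    then show "fst (r m) \<in> I"
      by auto
    show "b (r m) = m"
      using b that unfolding r_def by (metis bij_betw_inv_into_right)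
  qed
  have bI: "b (k, j) \<in> I" if "k \<in> I" for k j
    using b that by (auto simp: bij_betw_def)
  have rb: "r (b (k, j)) = (k, j)" if "k \<in> I" for k j
    using b that unfolding r_def by (simp add: bij_betw_inv_into_left)
  define f where "f = (\<lambda>m l. gap (snd (r m)) (l (fst (r m))))"
  define c where "c = (\<lambda>m l. digit (snd (r m)) (l (fst (r m))))"
  define \<psi> where "\<psi> = (\<lambda>\<alpha>. \<lambda>k\<in>I. expand (\<lambda>j. \<alpha> (b (k, j))))"
  have proj: "continuous_map L euclideanreal (\<lambda>l. l k)" if "k \<in> I" for k
    using that unfolding L_def by (rule continuous_map_product_projection)
  show thesis
  proof
    show "continuous_map L euclideanreal (f m)" if "m \<in> I" for m
    proof -
      have "continuous_map euclideanreal euclideanreal (gap (snd (r m)))"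
        by (simp add: continuous_at_imp_continuous_on isCont_gap)
      from continuous_map_compose[OF proj[OF rI[OF that]] this] show ?thesis
        by (simp add: f_def o_def)
    qed
    show "continuous_map (subtopology L {l. 0 < f m l}) (discrete_topology UNIV) (c m)" if "m \<in> I" for m
    proof -
      have "continuous_map (subtopology L {l. 0 < f m l}) (top_of_set {x. 0 < gap (snd (r m)) x}) (\<lambda>l. l (fst (r m)))"
        unfolding continuous_map_in_subtopology
        using proj[OF rI[OF that]] by (auto simp: f_def continuous_map_from_subtopology)
      moreover have "continuous_map (top_of_set {x. 0 < gap (snd (r m)) x}) euclidean (digit (snd (r m)))"
        by (simp add: continuous_at_imp_continuous_on isCont_digit)
      ultimately have "continuous_map (subtopology L {l. 0 < f m l}) euclidean (digit (snd (r m)) \<circ> (\<lambda>l. l (fst (r m))))"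
        by (rule continuous_map_compose)
      then show ?thesis
        by (simp add: c_def o_def euclidean_int_discrete)
    qed
    show "continuous_map N L \<psi>"
      unfolding L_def
    proof (rule continuous_map_coordinatewise_then_product)
      fix k assume k: "k \<in> I"
      have "continuous_map N (product_topology (\<lambda>_. euclidean) UNIV) (\<lambda>\<alpha> j. \<alpha> (b (k, j)))"
        unfolding continuous_map_componentwise_UNIV N_def euclidean_int_discrete
        using bI[OF k] by (auto intro: continuous_map_product_projection)
      then have "continuous_map N euclidean (\<lambda>\<alpha> j. \<alpha> (b (k, j)))"
        by (simp add: euclidean_product_topology)
      then have "continuous_map N euclideanreal (expand \<circ> (\<lambda>\<alpha> j. \<alpha> (b (k, j))))"
        by (rule continuous_map_compose) (simp add: continuous_expand)
      then show "continuous_map N euclideanreal (\<lambda>\<alpha>. \<psi> \<alpha> k)"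
        using k by (simp add: \<psi>_def o_def)
    qed (simp add: \<psi>_def)
    show "0 < f m (\<psi> \<alpha>)" if "m \<in> I" for m \<alpha>
      using rI[OF that] by (simp add: f_def \<psi>_def gap_expand_pos)
    show "c m (\<psi> \<alpha>) = \<alpha> m" if "m \<in> I" for m \<alpha>
      using rI[OF that] br[OF that] by (simp add: c_def \<psi>_def digit_expand)
    \<comment> \<open>As \<open>b\<close> is bijective, the digit sequences of different coordinates
      can be prescribed independently, so density may be checked coordinatewise.\<close>
    have "\<psi> ` topspace N = PiE I (\<lambda>_. range expand)"
    proof
      show "\<psi> ` topspace N \<subseteq> PiE I (\<lambda>_. range expand)"
        by (auto simp: \<psi>_def)
      show "PiE I (\<lambda>_. range expand) \<subseteq> \<psi> ` topspace N"
      proof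
        fix l assume l: "l \<in> PiE I (\<lambda>_. range expand)"
        then obtain \<beta> where \<beta>: "\<And>k. k \<in> I \<Longrightarrow> l k = expand (\<beta> k)"
          unfolding PiE_iff image_iff by metis
        define \<alpha> where "\<alpha> = (\<lambda>m\<in>I. \<beta> (fst (r m)) (snd (r m)))"
        have "(\<lambda>j. \<alpha> (b (k, j))) = \<beta> k" if "k \<in> I" for k
          using that by (simp add: \<alpha>_def bI rb)
        then have "\<psi> \<alpha> = l"
          using l \<beta> by (auto simp: \<psi>_def PiE_iff extensional_def fun_eq_iff)
        moreover have "\<alpha> \<in> topspace N"
          by (simp add: \<alpha>_def N_def)
        ultimately show "l \<in> \<psi> ` topspace N"
          by blast
      qed
    qed
    then show "L closure_of (\<psi> ` topspace N) = topspace L"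
      by (simp add: L_def closure_of_product_topology closure_range_expand)
    show "(\<lambda>_\<in>I. 0) \<in> topspace L"
      by (simp add: L_def)
    show "f m (\<lambda>_\<in>I. 0) = 0" if "m \<in> I" for m
      using rI[OF that] by (simp add: f_def)
  qed
qed

section \<open>The connectification\<close>

text \<open>Realizing the connectification inside \<open>W\<close> separates construction from
  properties: the separation axioms and metrizability are hereditary, so they can be checked on
  \<open>W\<close>.\<close>

lemma product_pathwise_connectification:
  fixes I :: "'m set" and X :: "'m \<Rightarrow> 'a topology" and q :: "'m \<Rightarrow> 'a \<Rightarrow> int"
  assumes "infinite I"
    and q: "\<And>m. m \<in> I \<Longrightarrow> continuous_map (X m) (discrete_topology UNIV) (q m)"
    and surj: "\<And>m. m \<in> I \<Longrightarrow> q m ` topspace (X m) = UNIV"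
  defines "W \<equiv> prod_topology (product_topology (\<lambda>_. euclideanreal) I) (product_topology (\<lambda>m. open_cone (X m)) I)"
  obtains S where "pathwise_connectification (product_topology X I) (subtopology W S)"
proof -
  define L where "L = product_topology (\<lambda>_. euclideanreal) I"
  define N where "N = product_topology (\<lambda>_. discrete_topology (UNIV :: int set)) I"
  define P where "P = product_topology X I"
  show thesis
  proof (rule product_coding[OF assms(1), folded L_def N_def])
    fix f :: "'m \<Rightarrow> ('m \<Rightarrow> real) \<Rightarrow> real" and c :: "'m \<Rightarrow> ('m \<Rightarrow> real) \<Rightarrow> int" and \<psi> l\<^sub>0
    assume f: "\<And>m. m \<in> I \<Longrightarrow> continuous_map L euclideanreal (f m)"
      and c: "\<And>m. m \<in> I \<Longrightarrow> continuous_map (subtopology L {l. 0 < f m l}) (discrete_topology UNIV) (c m)"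
      and \<psi>: "continuous_map N L \<psi>"
      and f\<psi>: "\<And>m \<alpha>. m \<in> I \<Longrightarrow> 0 < f m (\<psi> \<alpha>)"
      and c\<psi>: "\<And>m \<alpha>. m \<in> I \<Longrightarrow> c m (\<psi> \<alpha>) = \<alpha> m"
      and dense: "L closure_of (\<psi> ` topspace N) = topspace L"
      and l\<^sub>0: "l\<^sub>0 \<in> topspace L" and fl\<^sub>0: "\<And>m. m \<in> I \<Longrightarrow> f m l\<^sub>0 = 0"
    have "\<exists>z. z \<in> topspace (X m) \<and> q m z = k" if "m \<in> I" for m k
      using surj[OF that] by (metis UNIV_I imageE)
    then obtain z where z: "\<And>m k. m \<in> I \<Longrightarrow> z m k \<in> topspace (X m)" and qz: "\<And>m k. m \<in> I \<Longrightarrow> q m (z m k) = k"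
      by metis
    \<comment> \<open>A point with code \<open>k\<close>, equal to \<open>a\<close> whenever the
      code of \<open>a\<close> allows it; for fixed \<open>a\<close> it is continuous in
      \<open>k\<close> because codes are discrete.\<close>
    define r where "r = (\<lambda>m a k. if q m a = k then a else z m k)"
    have r: "r m a k \<in> topspace (X m)" "q m (r m a k) = k" if "m \<in> I" "a \<in> topspace (X m)" for m a k
      using that z qz by (auto simp: r_def)
    \<comment> \<open>The section that passes through the image of \<open>x\<close>. The digit
      \<open>c m l\<close> is consulted only where \<open>f m l\<close> is positive, which is where
      it is continuous.\<close>
    define \<sigma> where "\<sigma> = (\<lambda>x l. (l, \<lambda>m\<in>I. if 0 < f m l then (r m (x m) (c m l), f m l) else cone_apex))"
    define code where "code = (\<lambda>x. \<lambda>m\<in>I. q m (x m))"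
    define e where "e = (\<lambda>x. \<sigma> x (\<psi> (code x)))"
    define S where "S = (\<Union>x\<in>topspace P. \<sigma> x ` topspace L)"
    have xm: "x m \<in> topspace (X m)" if "x \<in> topspace P" "m \<in> I" for x m
      using that by (auto simp: P_def)
    \<comment> \<open>Over \<open>\<psi> (code x)\<close> every height is positive and every digit
      agrees with \<open>x\<close>, so no coordinate of \<open>x\<close> is replaced.\<close>
    have e: "e x = (\<psi> (code x), \<lambda>m\<in>I. (x m, f m (\<psi> (code x))))" for x
      using f\<psi> c\<psi> by (auto simp: e_def \<sigma>_def code_def r_def)
    have cont_\<sigma>: "continuous_map L W (\<sigma> x)" if x: "x \<in> topspace P" for x
      unfolding W_def L_def[symmetric] \<sigma>_def
    proof (rule continuous_map_pairedI)
      show "continuous_map L (product_topology (\<lambda>m. open_cone (X m)) I)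
          (\<lambda>l. \<lambda>m\<in>I. if 0 < f m l then (r m (x m) (c m l), f m l) else cone_apex)"
      proof (rule continuous_map_coordinatewise_then_product)
        fix m assume m: "m \<in> I"
        have "continuous_map (discrete_topology UNIV) (X m) (r m (x m))"
          using r(1)[OF m xm[OF x m]] by auto
        from continuous_map_compose[OF c[OF m] this]
        have "continuous_map (subtopology L {l. 0 < f m l}) (X m) (\<lambda>l. r m (x m) (c m l))"
          by (simp add: o_def)
        then have "continuous_map L (open_cone (X m))
            (\<lambda>l. if 0 < f m l then (r m (x m) (c m l), f m l) else cone_apex)"
          by (rule continuous_map_into_open_cone[OF f[OF m]])
        then show "continuous_map L (open_cone (X m))
            (\<lambda>l. (\<lambda>m\<in>I. if 0 < f m l then (r m (x m) (c m l), f m l) else cone_apex) m)"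
          using m by (simp add: o_def)
      qed simp
    qed simp
    have SW: "S \<subseteq> topspace W"
      unfolding S_def using continuous_map_image_subset_topspace[OF cont_\<sigma>] by blast
    have code: "code x \<in> topspace N" for x
      by (simp add: code_def N_def)
    have \<psi>L: "\<psi> \<alpha> \<in> topspace L" if "\<alpha> \<in> topspace N" for \<alpha>
      using continuous_map_image_subset_topspace[OF \<psi>] that by blast
    have eS: "e ` topspace P \<subseteq> S"
      using \<psi>L[OF code] by (auto simp: e_def S_def)
    have "path_connectedin W S"
    proof -
      have "path_connectedin W (\<sigma> x ` topspace L)" if "x \<in> topspace P" for x
        using cont_\<sigma>[OF that]
      proof (rule path_connectedin_continuous_map_image)
        show "path_connectedin L (topspace L)"
          unfolding path_connectedin_topspace L_def path_connected_space_product_topology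
          using path_connected_space_euclidean_subtopology[of "UNIV :: real set"] by simp
      qed
      \<comment> \<open>Over \<open>l\<^sub>0\<close> all heights vanish, so the value does not
        depend on \<open>x\<close> and all sections meet.\<close>
      moreover have "\<sigma> x l\<^sub>0 = (l\<^sub>0, \<lambda>m\<in>I. cone_apex)" for x
        using fl\<^sub>0 by (auto simp: \<sigma>_def)
      then have "(l\<^sub>0, \<lambda>m\<in>I. cone_apex) \<in> \<sigma> x ` topspace L" for x
        using l\<^sub>0 by (metis imageI)
      then have "\<Inter>((\<lambda>x. \<sigma> x ` topspace L) ` topspace P) \<noteq> {}"
        by blast
      ultimately show ?thesis
        unfolding S_def by (intro path_connectedin_Union) auto
    qed
    moreover have "embedding_map P W e"
    proof -
      let ?E = "subtopology W (e ` topspace P)"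
      define g where "g = (\<lambda>p::('m \<Rightarrow> real) \<times> ('m \<Rightarrow> 'a \<times> real). \<lambda>m\<in>I. fst (snd p m))"
      have "continuous_map P N code"
        unfolding N_def
      proof (rule continuous_map_coordinatewise_then_product)
        fix m assume m: "m \<in> I"
        have "continuous_map P (X m) (\<lambda>x. x m)"
          unfolding P_def using m by (rule continuous_map_product_projection)
        from continuous_map_compose[OF this q[OF m]]
        show "continuous_map P (discrete_topology UNIV) (\<lambda>x. code x m)"
          using m by (simp add: code_def o_def)
      qed (simp add: code_def)
      then have \<psi>code: "continuous_map P L (\<lambda>x. \<psi> (code x))"
        using continuous_map_compose[OF _ \<psi>] by (auto simp: o_def)
      have "continuous_map P W e"
        unfolding W_def L_def[symmetric] e
      proof (rule continuous_map_pairedI[OF \<psi>code], rule continuous_map_coordinatewise_then_product)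
        fix m assume m: "m \<in> I"
        have "continuous_map P (X m) (\<lambda>x. x m)"
          unfolding P_def using m by (rule continuous_map_product_projection)
        then have 1: "continuous_map (subtopology P {x. 0 < f m (\<psi> (code x))}) (X m) (\<lambda>x. x m)"
          by (rule continuous_map_from_subtopology)
        have "continuous_map P euclideanreal (\<lambda>x. f m (\<psi> (code x)))"
          using continuous_map_compose[OF \<psi>code f[OF m]] by (simp add: o_def)
        from continuous_map_into_open_cone[OF this 1]
        show "continuous_map P (open_cone (X m)) (\<lambda>x. (\<lambda>m\<in>I. (x m, f m (\<psi> (code x)))) m)"
          using m f\<psi>[OF m] by simp
      qed simp
      then have "continuous_map P ?E e"
        by (simp add: continuous_map_in_subtopology)
      moreover have "continuous_map ?E P g"
        unfolding P_def
      proof (rule continuous_map_coordinatewise_then_product)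
        fix m assume m: "m \<in> I"
        have "continuous_map W (open_cone (X m)) ((\<lambda>y. y m) \<circ> snd)"
          unfolding W_def using m
          by (intro continuous_map_compose[OF continuous_map_snd] continuous_map_product_projection)
        then have "continuous_map ?E (open_cone (X m)) (\<lambda>p. snd p m)"
          using continuous_map_from_subtopology by (auto simp: o_def)
        \<comment> \<open>Heights are positive on the image of \<open>e\<close>, so the coordinate
          stays where projection to the base is continuous.\<close>
        then have "continuous_map ?E (subtopology (open_cone (X m)) (UNIV \<times> {0<..})) (\<lambda>p. snd p m)"
          unfolding continuous_map_in_subtopology using m f\<psi>[OF m] by (auto simp: e)
        from continuous_map_compose[OF this continuous_map_open_cone_fst]
        show "continuous_map (subtopology W (e ` topspace (product_topology X I))) (X m) (\<lambda>p. g p m)"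
          using m by (simp add: g_def o_def P_def)
      qed (simp add: g_def)
      moreover have "g (e x) = x" if "x \<in> topspace P" for x
        using that by (auto simp: g_def e P_def PiE_iff extensional_def)
      ultimately have "homeomorphic_maps P ?E e g"
        by (auto simp: homeomorphic_maps_def)
      then show ?thesis
        unfolding embedding_map_def using homeomorphic_maps_map by blast
    qed
    moreover have "topspace W \<inter> S \<subseteq> W closure_of (e ` topspace P)"
    proof -
      have "\<sigma> x ` topspace L \<subseteq> W closure_of (e ` topspace P)" if x: "x \<in> topspace P" for x
      proof -
        have "\<sigma> x (\<psi> \<alpha>) \<in> e ` topspace P" if \<alpha>: "\<alpha> \<in> topspace N" for \<alpha>
        proof
          \<comment> \<open>Coordinates of \<open>x\<close> with the wrong code are replaced by
            points of code \<open>\<alpha> m\<close>; the image of the result is the point of the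
            section of \<open>x\<close> over \<open>\<psi> \<alpha>\<close>.\<close>
          let ?y = "\<lambda>m\<in>I. r m (x m) (\<alpha> m)"
          show "?y \<in> topspace P"
            using r(1) xm[OF x] by (simp add: P_def)
          have "code ?y = \<alpha>"
            using \<alpha> r(2) xm[OF x] by (auto simp: code_def N_def PiE_iff extensional_def fun_eq_iff)
          then show "\<sigma> x (\<psi> \<alpha>) = e ?y"
            using f\<psi> c\<psi> by (auto simp: e \<sigma>_def)
        qed
        then have "W closure_of (\<sigma> x ` \<psi> ` topspace N) \<subseteq> W closure_of (e ` topspace P)"
          by (intro closure_of_mono) auto
        \<comment> \<open>A continuous section carries the density of the range of
          \<open>\<psi>\<close> over to its own image.\<close>
        moreover have "\<sigma> x ` topspace L \<subseteq> W closure_of (\<sigma> x ` \<psi> ` topspace N)"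
          using continuous_map_image_closure_subset[OF cont_\<sigma>[OF x], of "\<psi> ` topspace N"] dense by simp
        ultimately show ?thesis
          by blast
      qed
      then show ?thesis
        by (auto simp: S_def)
    qed
    then have "subtopology W S closure_of (e ` topspace P) = topspace (subtopology W S)"
      using eS SW by (auto simp: closure_of_subtopology inf.absorb2)
    ultimately have "pathwise_connectification P (subtopology W S)"
      using eS unfolding pathwise_connectification_def path_connectedin_def
      by (auto simp: embedding_map_in_subtopology)
    then show ?thesis
      using that by (simp add: P_def)
  qed
qed

section \<open>Application to products of topological sums\<close>

theorem theorem1p1:
  fixes I :: "'m set" and J :: "'m \<Rightarrow> 'n set" and Z :: "'m \<Rightarrow> 'n \<Rightarrow> 'z topology"
  assumes "infinite I"
    and "\<And>m. m \<in> I \<Longrightarrow> infinite (J m)"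
    and "\<And>m n. m \<in> I \<Longrightarrow> n \<in> J m \<Longrightarrow> topspace (Z m n) \<noteq> {}"
  shows "(\<forall>i. (\<forall>m\<in>I. \<forall>n\<in>J m. T_space i (Z m n)) \<longrightarrow>
            has_T_pathwise_connectification i
              (product_topology (\<lambda>m. sum_topology (Z m) (J m)) I)) \<and>
         (countable I \<and> (\<forall>m\<in>I. \<forall>n\<in>J m. metrizable_space (Z m n)) \<longrightarrow>
            has_metrizable_pathwise_connectification
              (product_topology (\<lambda>m. sum_topology (Z m) (J m)) I))"
proof -
  define X where "X = (\<lambda>m. sum_topology (Z m) (J m))"
  define W where "W = prod_topology (product_topology (\<lambda>_. euclideanreal) I) (product_topology (\<lambda>m. open_cone (X m)) I)"
  \<comment> \<open>An infinite index set contains a copy of the naturals, which decode onto the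
    integers. Values off that copy may be arbitrary, since any function of the summand index is
    continuous on the sum.\<close>
  have "\<exists>h. h ` J m = (UNIV :: int set)" if m: "m \<in> I" for m
  proof -
    obtain e :: "nat \<Rightarrow> 'n" where e: "inj e" "range e \<subseteq> J m"
      using assms(2)[OF m] infinite_countable_subset by blast
    have "(int_decode \<circ> inv e) ` range e = UNIV"
      unfolding image_comp[symmetric] image_inv_f_f[OF e(1)] by (rule surj_int_decode)
    then have "(int_decode \<circ> inv e) ` J m = UNIV"
      using e(2) by blast
    then show ?thesis
      by blast
  qed
  then obtain h :: "'m \<Rightarrow> 'n \<Rightarrow> int" where h: "\<And>m. m \<in> I \<Longrightarrow> h m ` J m = UNIV"
    by metis
  obtain S where S: "pathwise_connectification (product_topology X I) (subtopology W S)"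
    unfolding W_def
  proof (rule product_pathwise_connectification[OF assms(1)])
    show "continuous_map (X m) (discrete_topology UNIV) (h m \<circ> fst)" if "m \<in> I" for m
    proof -
      have "openin (X m) {p \<in> topspace (X m). (h m \<circ> fst) p \<in> V}" for V
      proof -
        have "{p \<in> topspace (X m). (h m \<circ> fst) p \<in> V} = Sigma (J m) (\<lambda>n. if h m n \<in> V then topspace (Z m n) else {})"
          by (auto simp: X_def split: if_splits)
        then show ?thesis
          by (simp add: X_def openin_disjoint_union)
      qed
      then show ?thesis
        by (simp add: continuous_map_def)
    qed
    show "(h m \<circ> fst) ` topspace (X m) = UNIV" if m: "m \<in> I" for m
    proof -
      have "fst ` topspace (X m) = J m"
        using assms(3)[OF m] by (auto simp: X_def fst_image_Sigma)
      then show ?thesis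
        unfolding image_comp[symmetric] using h[OF m] by simp
    qed
  qed
  have "has_T_pathwise_connectification i (product_topology X I)"
    if T: "\<forall>m\<in>I. \<forall>n\<in>J m. T_space i (Z m n)" for i
  proof (rule has_T_pathwise_connectificationI[OF _ S])
    have "T_space i W"
      unfolding W_def X_def using T
      by (intro T_space_prod_topology T_space_product_topology T_space_open_cone_sum
          metrizable_imp_T_space[OF metrizable_space_euclidean]) auto
    then show "T_space i (subtopology W S)"
      by (rule T_space_subtopology)
  qed
  moreover have "has_metrizable_pathwise_connectification (product_topology X I)"
    if "countable I" and M: "\<forall>m\<in>I. \<forall>n\<in>J m. metrizable_space (Z m n)"
  proof (rule has_metrizable_pathwise_connectificationI[OF _ S])
    have "metrizable_space (open_cone (X m))" if "m \<in> I" for m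
      unfolding X_def using M that by (intro metrizable_space_open_cone metrizable_space_sum_topology) auto
    \<comment> \<open>A product of metrizable spaces is metrizable when at most countably many
      factors are nontrivial; countability of \<open>I\<close> enters here.\<close>
    moreover have "countable {i \<in> I. P i}" for P
      using \<open>countable I\<close> by simp
    ultimately have "metrizable_space W"
      unfolding W_def
      by (simp add: metrizable_space_prod_topology metrizable_space_product_topology metrizable_space_euclidean)
    then show "metrizable_space (subtopology W S)"
      by (rule metrizable_space_subtopology)
  qed
  ultimately show ?thesis
    unfolding X_def by blast
qed

end
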